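(* Let $C_n$ be the cycle on $n\ge3$ vertices, with ambient polynomial ring $Q$. The minimal $Q$-free resolution of $Q/I_{C_n}$ admits the structure of a differential graded algebra if and only if $n\le 5$.
   Context: For a graph on vertices $x_1,\ldots,x_n$, $Q=\Bbbk[x_1,\ldots,x_n]$ over a field $\Bbbk$ and the edge ideal is generated by $x_ix_j$ for edges $\{x_i,x_j\}$. A dg algebra structure on a complex of free $Q$-modules is a unital associative multiplication with $\mathcal{A}_i\mathcal{A}_j\subseteq\mathcal{A}_{i+j}$, $ab=(-1)^{|a||b|}ba$, $a^2=0$ for odd $|a|$, and $\partial(ab)=\partial(a)b+(-1)^{|a|}a\partial(b)$. *)

theory Defs
  imports Main "HOL-Library.Poly_Mapping"
begin

text \<open>Multivariate polynomial ring Q = k[x_v : v in 'v] over a field k, where the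
  finite type 'v is the vertex set of the graph.  Polynomials are finitely supported
  maps from monomials (exponent vectors 'v =>0 nat) to coefficients.\<close>

type_synonym ('v, 'k) mpoly = "('v \<Rightarrow>\<^sub>0 nat) \<Rightarrow>\<^sub>0 'k"

definition Var :: "'v \<Rightarrow> ('v, 'k::field) mpoly" where
  "Var v = Poly_Mapping.single (Poly_Mapping.single v 1) 1"

definition edge_ideal :: "('v::finite \<Rightarrow> 'v \<Rightarrow> bool) \<Rightarrow> ('v, 'k::field) mpoly set" where
  "edge_ideal E = {(\<Sum>e\<in>{(u, w). E u w}. c e * Var (fst e) * Var (snd e)) | c. True}"

definition is_cycle_graph :: "('v::finite \<Rightarrow> 'v \<Rightarrow> bool) \<Rightarrow> bool" where
  "is_cycle_graph E \<longleftrightarrow> (\<exists>f. bij_betw f {..<card (UNIV::'v set)} (UNIV::'v set) \<and>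
     (\<forall>u w. E u w \<longleftrightarrow> (\<exists>i<card (UNIV::'v set). {u, w} = {f i, f ((i + 1) mod card (UNIV::'v set))})))"

text \<open>A complex of finitely generated free graded Q-modules F_i = Q^(b i), i >= 0.
  Elements of F_i are coordinate vectors nat => Q supported on {..< b i}; the j-th basis
  element of F_i has internal degree deg i j.  The differential d_i : F_i -> F_(i-1)
  (i >= 1) is given by the matrix D i (entry D i r c, row r < b (i-1), column c < b i),
  and d_0 = 0.\<close>

definition fmod :: "(nat \<Rightarrow> nat) \<Rightarrow> nat \<Rightarrow> (nat \<Rightarrow> ('v, 'k::field) mpoly) set" where
  "fmod b i = {v. \<forall>j\<ge>b i. v j = 0}"

definition dmap :: "(nat \<Rightarrow> nat) \<Rightarrow> (nat \<Rightarrow> nat \<Rightarrow> nat \<Rightarrow> ('v, 'k::field) mpoly) \<Rightarrow> nat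
    \<Rightarrow> (nat \<Rightarrow> ('v, 'k) mpoly) \<Rightarrow> (nat \<Rightarrow> ('v, 'k) mpoly)" where
  "dmap b D i v = (\<lambda>r. if i = 0 \<or> r \<ge> b (i - 1) then 0 else (\<Sum>c<b i. D i r c * v c))"

definition vadd :: "(nat \<Rightarrow> ('v, 'k::field) mpoly) \<Rightarrow> (nat \<Rightarrow> ('v, 'k) mpoly) \<Rightarrow> (nat \<Rightarrow> ('v, 'k) mpoly)" where
  "vadd a c = (\<lambda>j. a j + c j)"

definition smul :: "('v, 'k::field) mpoly \<Rightarrow> (nat \<Rightarrow> ('v, 'k) mpoly) \<Rightarrow> (nat \<Rightarrow> ('v, 'k) mpoly)" where
  "smul s a = (\<lambda>j. s * a j)"

text \<open>(b, deg, D) is a minimal graded free resolution of Q/I: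
  F_0 = Q (generator in degree 0), the differentials are homogeneous of degree 0
  (entries homogeneous of the appropriate degree), minimality (all entries lie in
  the homogeneous maximal ideal, i.e. have zero constant term), the image of d_1
  in F_0 = Q is I, and the complex is exact at F_i for all i >= 1.\<close>

definition minimal_graded_free_resolution ::
  "('v::finite, 'k::field) mpoly set \<Rightarrow> (nat \<Rightarrow> nat) \<Rightarrow> (nat \<Rightarrow> nat \<Rightarrow> nat)
     \<Rightarrow> (nat \<Rightarrow> nat \<Rightarrow> nat \<Rightarrow> ('v, 'k) mpoly) \<Rightarrow> bool" where
  "minimal_graded_free_resolution I b deg D \<longleftrightarrow>
     b 0 = 1 \<and> deg 0 0 = 0 \<and>
     (\<forall>i\<ge>1. \<forall>r<b (i - 1). \<forall>c<b i.
        (\<forall>m\<in>Poly_Mapping.keys (D i r c). (\<Sum>v\<in>UNIV. Poly_Mapping.lookup m v) + deg (i - 1) r = deg i c)) \<and>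
     (\<forall>i\<ge>1. \<forall>r<b (i - 1). \<forall>c<b i. Poly_Mapping.lookup (D i r c) 0 = 0) \<and>
     {dmap b D 1 v 0 | v. v \<in> fmod b 1} = I \<and>
     (\<forall>i\<ge>1. {v \<in> fmod b i. dmap b D i v = (\<lambda>_. 0)} = dmap b D (i + 1) ` fmod b (i + 1))"

text \<open>A dg algebra structure on the complex (b, D): a Q-bilinear multiplication
  F_i x F_j -> F_(i+j) which is unital, associative, graded-commutative, squares odd
  elements to zero and satisfies the Leibniz rule.  (Multiplication is given on
  homogeneous components; the total product is its bilinear extension.)\<close>

definition is_dga_structure ::
  "(nat \<Rightarrow> nat) \<Rightarrow> (nat \<Rightarrow> nat \<Rightarrow> nat \<Rightarrow> ('v::finite, 'k::field) mpoly)
     \<Rightarrow> (nat \<Rightarrow> nat \<Rightarrow> (nat \<Rightarrow> ('v, 'k) mpoly) \<Rightarrow> (nat \<Rightarrow> ('v, 'k) mpoly) \<Rightarrow> (nat \<Rightarrow> ('v, 'k) mpoly))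
     \<Rightarrow> bool" where
  "is_dga_structure b D mult \<longleftrightarrow>
     (\<forall>i j a c. a \<in> fmod b i \<longrightarrow> c \<in> fmod b j \<longrightarrow> mult i j a c \<in> fmod b (i + j)) \<and>
     (\<forall>i j a a' c. a \<in> fmod b i \<longrightarrow> a' \<in> fmod b i \<longrightarrow> c \<in> fmod b j \<longrightarrow>
        mult i j (vadd a a') c = vadd (mult i j a c) (mult i j a' c)) \<and>
     (\<forall>i j a c c'. a \<in> fmod b i \<longrightarrow> c \<in> fmod b j \<longrightarrow> c' \<in> fmod b j \<longrightarrow>
        mult i j a (vadd c c') = vadd (mult i j a c) (mult i j a c')) \<and>
     (\<forall>i j s a c. a \<in> fmod b i \<longrightarrow> c \<in> fmod b j \<longrightarrow>
        mult i j (smul s a) c = smul s (mult i j a c) \<and>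
        mult i j a (smul s c) = smul s (mult i j a c)) \<and>
     (\<exists>e\<in>fmod b 0. \<forall>j a. a \<in> fmod b j \<longrightarrow> mult 0 j e a = a \<and> mult j 0 a e = a) \<and>
     (\<forall>i j k a c f. a \<in> fmod b i \<longrightarrow> c \<in> fmod b j \<longrightarrow> f \<in> fmod b k \<longrightarrow>
        mult (i + j) k (mult i j a c) f = mult i (j + k) a (mult j k c f)) \<and>
     (\<forall>i j a c. a \<in> fmod b i \<longrightarrow> c \<in> fmod b j \<longrightarrow>
        mult i j a c = smul ((-1) ^ (i * j)) (mult j i c a)) \<and>
     (\<forall>i a. odd i \<longrightarrow> a \<in> fmod b i \<longrightarrow> mult i i a a = (\<lambda>_. 0)) \<and>
     (\<forall>i j a c. a \<in> fmod b i \<longrightarrow> c \<in> fmod b j \<longrightarrow>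
        dmap b D (i + j) (mult i j a c) =
          vadd (mult (i - 1) j (dmap b D i a) c) (smul ((-1) ^ i) (mult i (j - 1) a (dmap b D j c))))"

end

theory Submission
  imports Defs "HOL-Library.Function_Algebras"
begin

text \<open>
  Let the vertices be \<open>x\<^sub>0, \<dots>, x\<^bsub>n-1\<^esub>\<close> and \<open>e\<^sub>i \<in> F\<^sub>1\<close> a lift of the edge
  \<open>x\<^sub>i x\<^bsub>i+1\<^esub>\<close>; let \<open>g\<^sub>i \<in> F\<^sub>2\<close> satisfy \<open>d g\<^sub>i = x\<^sub>i e\<^bsub>i+1\<^esub> - x\<^bsub>i+2\<^esub> e\<^sub>i\<close>.

  For \<open>n \<ge> 6\<close> associativity already fails for the product of \<open>e\<^sub>0, e\<^sub>2, e\<^sub>4\<close>. Filter the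
  resolution by total degree. Since \<open>F\<^sub>3\<close> has no generators of degree less than 5 and \<open>F\<^sub>4\<close> none of
  degree less than 6, the Leibniz rule determines the lowest degree part of every product
  \<open>F\<^sub>1 F\<^sub>1\<close> and \<open>F\<^sub>1 F\<^sub>2\<close>, whether or not the product is homogeneous. In particular
  \<open>e\<^sub>0 e\<^sub>2 = x\<^sub>0 g\<^sub>1 + x\<^sub>3 g\<^sub>0\<close> and \<open>e\<^sub>2 e\<^sub>4 = x\<^sub>2 g\<^sub>3 + x\<^sub>5 g\<^sub>2\<close> up to boundaries that do not matter,
  so \<open>(e\<^sub>0 e\<^sub>2) e\<^sub>4 = e\<^sub>0 (e\<^sub>2 e\<^sub>4)\<close> is in degree 6 a linear relation with coefficients
  \<open>x\<^sub>0, x\<^sub>3, x\<^sub>2, x\<^sub>5\<close> between constant vectors. Hence the degree 5 part of \<open>e\<^sub>0 g\<^sub>3\<close> vanishes, and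
  applying the differential repeatedly shows that \<open>x\<^sub>4 x\<^sub>5\<close> would have degree at least 3.

  For \<open>n \<le> 5\<close> the \<open>g\<^sub>i\<close> generate all syzygies of the edges and satisfy a single relation, so
  \<open>0 \<rightarrow> Q \<rightarrow> Q\<^sup>n \<rightarrow> Q\<^sup>n \<rightarrow> Q\<close> is a free resolution of \<open>Q/I\<close>. Thus the minimal resolution has length
  at most 3, and a product on \<open>F\<^sub>1 F\<^sub>1\<close> and \<open>F\<^sub>1 F\<^sub>2\<close> obtained by lifting the Leibniz rule is
  automatically associative because \<open>d\<^sub>3\<close> is injective (Buchsbaum and Eisenbud).
\<close>

section \<open>Polynomials and vectors\<close>

abbreviation lookup :: "('a \<Rightarrow>\<^sub>0 'b::zero) \<Rightarrow> 'a \<Rightarrow> 'b" where "lookup \<equiv> Poly_Mapping.lookup"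
abbreviation keys :: "('a \<Rightarrow>\<^sub>0 'b::zero) \<Rightarrow> 'a set" where "keys \<equiv> Poly_Mapping.keys"

section \<open>Total degree, order of vanishing and division by a variable\<close>

definition tdeg :: "('v::finite \<Rightarrow>\<^sub>0 nat) \<Rightarrow> nat" where
  "tdeg m = (\<Sum>v\<in>UNIV. lookup m v)"

lemma tdeg_add: "tdeg (m + m') = tdeg m + tdeg m'"
  by (simp add: tdeg_def lookup_add sum.distrib)

lemma tdeg_zero [simp]: "tdeg 0 = 0"
  by (simp add: tdeg_def)

lemma tdeg_single [simp]: "tdeg (Poly_Mapping.single v k) = k"
  by (simp add: tdeg_def lookup_single when_def)

lemma tdeg_eq_0_iff: "tdeg m = 0 \<longleftrightarrow> m = 0"
  by (auto simp: tdeg_def intro: poly_mapping_eqI)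

text \<open>Membership in the k-th power of the homogeneous maximal ideal, phrased through the
  monomials that occur; the zero polynomial satisfies every bound.\<close>

definition ordge :: "nat \<Rightarrow> ('v::finite, 'k::field) mpoly \<Rightarrow> bool" where
  "ordge k p \<longleftrightarrow> (\<forall>m\<in>keys p. k \<le> tdeg m)"

lemma ordge_iff: "ordge k p \<longleftrightarrow> (\<forall>m. tdeg m < k \<longrightarrow> lookup p m = 0)"
  by (meson in_keys_iff not_le ordge_def)

lemma ordge_zero [simp]: "ordge k 0"
  by (simp add: ordge_iff)

lemma ordge_0 [simp]: "ordge 0 p"
  by (simp add: ordge_iff)

lemma ordge_mono: "ordge k p \<Longrightarrow> l \<le> k \<Longrightarrow> ordge l p"
  by (auto simp: ordge_iff)

lemma ordge_add: "ordge k p \<Longrightarrow> ordge k q \<Longrightarrow> ordge k (p + q)"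
  by (simp add: ordge_iff lookup_add)

lemma ordge_diff: "ordge k p \<Longrightarrow> ordge k q \<Longrightarrow> ordge k (p - q)"
  by (simp add: ordge_iff lookup_minus)

lemma ordge_sum: "(\<And>i. i \<in> A \<Longrightarrow> ordge k (f i)) \<Longrightarrow> ordge k (sum f A)"
  by (simp add: ordge_iff lookup_sum)

lemma ordge_mult: "ordge k p \<Longrightarrow> ordge l q \<Longrightarrow> ordge (k + l) (p * q)"
  unfolding ordge_def using keys_mult[of p q] by (force simp: tdeg_add intro: add_mono)

lemma ordge_1_iff: "ordge 1 p \<longleftrightarrow> lookup p 0 = 0"
  by (simp add: ordge_iff tdeg_eq_0_iff)

lemma lookup_Var_mult: "lookup (Var v * p) (Poly_Mapping.single v 1 + m) = lookup p m"
  by (simp add: Var_def lookup_mult lookup_single when_mult)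

lemma lookup_Var_mult_eq_0: "lookup m v = 0 \<Longrightarrow> lookup (Var v * p) m = 0"
proof (rule ccontr)
  assume m: "lookup m v = 0" and "lookup (Var v * p) m \<noteq> 0"
  then have "m \<in> keys (Var v * p)" by (simp add: in_keys_iff)
  then obtain l where "m = Poly_Mapping.single v 1 + l"
    using keys_mult[of "Var v" p] by (auto simp: Var_def split: if_splits)
  then show False using m by (simp add: lookup_add)
qed

lemma Var_mult_cancel: "Var v * p = Var v * q \<Longrightarrow> p = q"
  by (metis lookup_Var_mult poly_mapping_eqI)

lemma Var_mult_eq_0: "Var v * p = 0 \<Longrightarrow> p = 0"
  by (metis Var_mult_cancel mult_zero_right)

text \<open>The quotient arises by lowering the exponent of \<open>v\<close> by one in every
  monomial, that is, by pulling \<open>p\<close> back along the injective shift of exponent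
  vectors.\<close>

lemma Var_dvdI:
  assumes "\<And>m. m \<in> keys p \<Longrightarrow> lookup m v \<noteq> 0"
  obtains q where "p = Var v * q"
proof
  let ?f = "\<lambda>m. Poly_Mapping.single v (1::nat) + m"
  have inj: "inj ?f" by (simp add: inj_on_def)
  show "p = Var v * Poly_Mapping.map_key ?f p"
  proof (rule poly_mapping_eqI)
    fix m
    show "lookup p m = lookup (Var v * Poly_Mapping.map_key ?f p) m"
    proof (cases "lookup m v = 0")
      case True
      then show ?thesis using assms by (metis in_keys_iff lookup_Var_mult_eq_0)
    next
      case False
      \<comment> \<open>Subtraction of exponents truncates at zero, so this decomposition needs
        \<open>v\<close> to occur in \<open>m\<close>.\<close>
      then have "m = ?f (m - Poly_Mapping.single v 1)"
        by (auto intro!: poly_mapping_eqI simp: lookup_add lookup_minus lookup_single when_def)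
      then show ?thesis
        by (metis (no_types) inj lookup_Var_mult map_key.rep_eq comp_apply)
    qed
  qed
qed

text \<open>A monomial of \<open>p\<close> times \<open>a\<close> is a monomial of a multiple of
  \<open>Var b\<close>, so \<open>b\<close> occurs in it; as \<open>a\<close> differs from
  \<open>b\<close>, it occurs already in the monomial of \<open>p\<close>.\<close>

lemma Var_coprime:
  assumes "Var a * p = Var b * q" and "a \<noteq> b"
  obtains s where "p = Var b * s" and "q = Var a * s"
proof -
  have "lookup m b \<noteq> 0" if "m \<in> keys p" for m
  proof
    assume "lookup m b = 0"
    then have "lookup (Var b * q) (Poly_Mapping.single a 1 + m) = 0"
      using assms(2) by (intro lookup_Var_mult_eq_0) (simp add: lookup_add lookup_single)
    then show False using that assms(1) by (metis in_keys_iff lookup_Var_mult)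
  qed
  then obtain s where s: "p = Var b * s" by (metis Var_dvdI)
  then have "Var b * (Var a * s) = Var b * q" using assms(1) by (simp add: algebra_simps)
  then have "q = Var a * s" by (metis Var_mult_cancel)
  with s show thesis by (rule that)
qed

section \<open>Free modules of finite rank and their linear maps\<close>

text \<open>The module \<open>fmod b i\<close> with only its rank as parameter, so that the linear
  algebra also applies to complexes other than the given resolution.\<close>

definition vsp :: "nat \<Rightarrow> (nat \<Rightarrow> 'a::zero) set" where
  "vsp N = {v. \<forall>j\<ge>N. v j = 0}"

definition ev :: "nat \<Rightarrow> nat \<Rightarrow> ('v, 'k::field) mpoly" where
  "ev c = (\<lambda>j. if j = c then 1 else 0)"

text \<open>Maps are total functions on all sequences; linearity is demanded only on vectors
  supported below \<open>N\<close>.\<close>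

definition lin :: "nat \<Rightarrow> nat \<Rightarrow> ((nat \<Rightarrow> ('v, 'k::field) mpoly) \<Rightarrow> (nat \<Rightarrow> ('v, 'k) mpoly)) \<Rightarrow> bool" where
  "lin N M f \<longleftrightarrow> (\<forall>u\<in>vsp N. f u \<in> vsp M) \<and> (\<forall>u\<in>vsp N. \<forall>v\<in>vsp N. f (u + v) = f u + f v)
     \<and> (\<forall>s. \<forall>u\<in>vsp N. f (smul s u) = smul s (f u))"

lemma vadd_eq: "vadd a c = a + c"
  by (simp add: vadd_def plus_fun_def)

lemma fmod_eq: "fmod b i = vsp (b i)"
  by (simp add: fmod_def vsp_def)

lemma smul_apply [simp]: "smul s a j = s * a j"
  by (simp add: smul_def)

lemma smul_add: "smul s (a + c) = smul s a + smul s c"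
  and smul_diff: "smul s (a - c) = smul s a - smul s c"
  and smul_add_left: "smul (s + t) a = smul s a + smul t a"
  and smul_smul: "smul s (smul t a) = smul (s * t) a"
  and smul_minus: "smul s (- a) = - smul s a"
  and smul_minus_left: "smul (- s) a = - smul s a"
  by (simp_all add: fun_eq_iff algebra_simps)

lemma smul_zero [simp]: "smul s 0 = 0" and smul_zero_left [simp]: "smul 0 a = 0"
  and smul_one [simp]: "smul 1 a = a"
  by (simp_all add: fun_eq_iff)

lemma sum_fun_apply: "sum f A j = (\<Sum>i\<in>A. f i j)"
  by (induction A rule: infinite_finite_induct) auto

lemma smul_sum: "smul s (sum f A) = (\<Sum>i\<in>A. smul s (f i))"
  by (simp add: fun_eq_iff sum_fun_apply sum_distrib_left)

lemma vsp_zero [simp]: "0 \<in> vsp N"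
  and vsp_add: "u \<in> vsp N \<Longrightarrow> v \<in> vsp N \<Longrightarrow> u + v \<in> vsp N"
  and vsp_diff: "u \<in> vsp N \<Longrightarrow> v \<in> vsp N \<Longrightarrow> u - v \<in> vsp N"
  and vsp_minus: "u \<in> vsp N \<Longrightarrow> - u \<in> vsp N"
  and vsp_smul: "u \<in> vsp N \<Longrightarrow> smul s u \<in> vsp N"
  for u v :: "nat \<Rightarrow> ('v, 'k::field) mpoly"
  by (auto simp: vsp_def)

lemma vsp_sum: "(\<And>i. i \<in> A \<Longrightarrow> f i \<in> vsp N) \<Longrightarrow> sum f A \<in> vsp N"
  for f :: "'a \<Rightarrow> nat \<Rightarrow> ('v, 'k::field) mpoly"
  by (induction A rule: infinite_finite_induct) (auto intro: vsp_add)

lemma ev_vsp: "c < N \<Longrightarrow> ev c \<in> vsp N"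
  by (simp add: ev_def vsp_def)

lemmas vsp_intros = vsp_zero vsp_add vsp_diff vsp_minus vsp_smul vsp_sum ev_vsp

lemma vsp_0_eq: "u \<in> vsp 0 \<longleftrightarrow> u = 0"
  by (auto simp: vsp_def fun_eq_iff)

lemma vsp_1_eq: "u \<in> vsp 1 \<Longrightarrow> u = smul (u 0) (ev 0)"
  by (auto simp: vsp_def fun_eq_iff ev_def)

lemma vsp_1_eqI: "u \<in> vsp 1 \<Longrightarrow> v \<in> vsp 1 \<Longrightarrow> u 0 = v 0 \<Longrightarrow> u = v"
  unfolding vsp_def by (simp add: fun_eq_iff) (metis One_nat_def Suc_le_eq not_gr_zero)

lemma vsp_expand:
  assumes "v \<in> vsp N"
  shows "v = (\<Sum>c<N. smul (v c) (ev c))"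
proof
  fix j
  have "(\<Sum>c<N. smul (v c) (ev c) j) = (\<Sum>c<N. if c = j then v c else 0)"
    by (intro sum.cong) (auto simp: ev_def)
  also have "\<dots> = v j" using assms by (auto simp: vsp_def)
  finally show "v j = (\<Sum>c<N. smul (v c) (ev c)) j" by (simp add: sum_fun_apply)
qed

lemma lin_vsp: "lin N M f \<Longrightarrow> u \<in> vsp N \<Longrightarrow> f u \<in> vsp M"
  and lin_plus: "lin N M f \<Longrightarrow> u \<in> vsp N \<Longrightarrow> v \<in> vsp N \<Longrightarrow> f (u + v) = f u + f v"
  and lin_smul: "lin N M f \<Longrightarrow> u \<in> vsp N \<Longrightarrow> f (smul s u) = smul s (f u)"
  by (auto simp: lin_def)

lemma lin_zero: "lin N M f \<Longrightarrow> f 0 = 0"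
  using lin_smul[of N M f 0 0] by simp

lemma lin_minus: "lin N M f \<Longrightarrow> u \<in> vsp N \<Longrightarrow> f (- u) = - f u"
  using lin_smul[of N M f u "-1"] by (simp add: smul_minus_left)

lemma lin_minus2: "lin N M f \<Longrightarrow> u \<in> vsp N \<Longrightarrow> v \<in> vsp N \<Longrightarrow> f (u - v) = f u - f v"
  using lin_plus[of N M f u "- v"] lin_minus[of N M f v] by (simp add: vsp_minus)

lemma lin_sum: "lin N M f \<Longrightarrow> (\<And>i. i \<in> A \<Longrightarrow> g i \<in> vsp N) \<Longrightarrow> f (sum g A) = (\<Sum>i\<in>A. f (g i))"
  by (induction A rule: infinite_finite_induct) (auto simp: lin_zero lin_plus vsp_sum)

lemma lin_expand:
  assumes "lin N M f" "v \<in> vsp N"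
  shows "f v = (\<Sum>c<N. smul (v c) (f (ev c)))"
proof -
  have "f v = f (\<Sum>c<N. smul (v c) (ev c))" using vsp_expand[OF assms(2)] by simp
  also have "\<dots> = (\<Sum>c<N. f (smul (v c) (ev c)))"
    by (rule lin_sum[OF assms(1)]) (auto intro: vsp_intros)
  also have "\<dots> = (\<Sum>c<N. smul (v c) (f (ev c)))"
    by (intro sum.cong) (auto intro: vsp_intros lin_smul[OF assms(1)])
  finally show ?thesis .
qed

lemma lin_compose: "lin N M f \<Longrightarrow> lin M K g \<Longrightarrow> lin N K (\<lambda>v. g (f v))"
  by (simp add: lin_def)

lemma lin_diff: "lin N M f \<Longrightarrow> lin N M g \<Longrightarrow> lin N M (\<lambda>v. f v - g v)"
  by (simp add: lin_def smul_diff vsp_diff)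

lemma lin_id: "lin N N (\<lambda>v. v)"
  by (simp add: lin_def)

lemma lin_combination:
  assumes "\<And>c. c < N \<Longrightarrow> y c \<in> vsp M"
  shows "lin N M (\<lambda>v. \<Sum>c<N. smul (v c) (y c))"
  unfolding lin_def using assms
  by (auto intro!: vsp_intros simp: smul_add_left sum.distrib smul_sum smul_smul)

lemma combination_ev: "c < N \<Longrightarrow> (\<Sum>j<N. smul (ev c j) (y j)) = y c"
proof -
  assume "c < N"
  have "(\<Sum>j<N. smul (ev c j) (y j)) = (\<Sum>j<N. if c = j then y j else 0)"
    by (intro sum.cong) (auto simp: ev_def)
  then show ?thesis using \<open>c < N\<close> by simp
qed

text \<open>Projectivity of a free module: preimages are chosen for the basis vectors and extended
  linearly.\<close>

lemma lin_lift:
  assumes f: "lin N M f" and g: "lin K M g"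
    and sub: "\<And>v. v \<in> vsp N \<Longrightarrow> f v \<in> g ` vsp K"
  obtains h where "lin N K h" and "\<And>v. v \<in> vsp N \<Longrightarrow> g (h v) = f v"
proof -
  have "\<forall>c. \<exists>y. c < N \<longrightarrow> y \<in> vsp K \<and> g y = f (ev c)"
    using sub ev_vsp by (metis imageE)
  then obtain y where y: "\<And>c. c < N \<Longrightarrow> y c \<in> vsp K \<and> g (y c) = f (ev c)" by metis
  define h where "h = (\<lambda>v. \<Sum>c<N. smul (v c) (y c))"
  have "lin N K h" unfolding h_def by (rule lin_combination) (simp add: y)
  moreover have "g (h v) = f v" if "v \<in> vsp N" for v
  proof -
    have "g (h v) = (\<Sum>c<N. g (smul (v c) (y c)))"
      unfolding h_def by (rule lin_sum[OF g]) (auto intro: vsp_intros simp: y)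
    also have "\<dots> = (\<Sum>c<N. smul (v c) (f (ev c)))"
      by (intro sum.cong) (auto simp: y lin_smul[OF g])
    finally show ?thesis using lin_expand[OF f that] by simp
  qed
  ultimately show thesis by (rule that)
qed

lemma dmap_vsp: "dmap b D i v \<in> vsp (b (i - 1))"
  by (simp add: dmap_def vsp_def)

lemma dmap_lin: "lin (b i) (b (i - 1)) (dmap b D i)"
  unfolding lin_def
  by (auto simp: vsp_def fun_eq_iff dmap_def algebra_simps sum.distrib sum_distrib_left)

lemma dmap_0: "dmap b D 0 v = 0"
  by (simp add: dmap_def fun_eq_iff)

lemma dmap_ev: "1 \<le> i \<Longrightarrow> c < b i \<Longrightarrow> r < b (i - 1) \<Longrightarrow> dmap b D i (ev c) r = D i r c"
proof -
  assume *: "1 \<le> i" "c < b i" "r < b (i - 1)"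
  have "(\<Sum>j<b i. D i r j * ev c j) = (\<Sum>j<b i. if c = j then D i r j else 0)"
    by (intro sum.cong) (auto simp: ev_def)
  then show ?thesis using * by (simp add: dmap_def)
qed

(* "b 1" and "d 1" must keep a single normal form under simplification. *)
declare One_nat_def [simp del]

section \<open>Minimal graded free resolutions\<close>

locale minimal_resolution =
  fixes I :: "('v::finite, 'k::field) mpoly set" and b deg D
  assumes res: "minimal_graded_free_resolution I b deg D"
begin

abbreviation d where "d \<equiv> dmap b D"

lemma b_0: "b 0 = 1"
  using res unfolding minimal_graded_free_resolution_def by (elim conjE)

lemma deg_0: "deg 0 0 = 0"
  using res unfolding minimal_graded_free_resolution_def by (elim conjE)

lemma homogeneous:
  assumes "1 \<le> i" "r < b (i - 1)" "c < b i" "m \<in> keys (D i r c)"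
  shows "tdeg m + deg (i - 1) r = deg i c"
proof -
  have "\<forall>i\<ge>1. \<forall>r<b (i - 1). \<forall>c<b i. \<forall>m\<in>keys (D i r c). tdeg m + deg (i - 1) r = deg i c"
    using res unfolding minimal_graded_free_resolution_def tdeg_def by (elim conjE)
  with assms show ?thesis by simp
qed

lemma minimal:
  assumes "1 \<le> i" "r < b (i - 1)" "c < b i"
  shows "ordge 1 (D i r c)"
proof -
  have "\<forall>i\<ge>1. \<forall>r<b (i - 1). \<forall>c<b i. lookup (D i r c) 0 = 0"
    using res unfolding minimal_graded_free_resolution_def by (elim conjE)
  with assms show ?thesis unfolding ordge_1_iff by simp
qed

lemma d1_image: "{d 1 v 0 | v. v \<in> vsp (b 1)} = I"
  using res unfolding minimal_graded_free_resolution_def fmod_eq by (elim conjE)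

lemma d1_in_ideal: "v \<in> vsp (b 1) \<Longrightarrow> d 1 v 0 \<in> I"
  using d1_image by blast

lemma d1_onto_ideal:
  assumes "p \<in> I" obtains v where "v \<in> vsp (b 1)" "d 1 v 0 = p"
  using assms d1_image by blast

lemma exact:
  assumes "1 \<le> i"
  shows "{v \<in> vsp (b i). d i v = 0} = d (i + 1) ` vsp (b (i + 1))"
proof -
  have "\<forall>i\<ge>1. {v \<in> vsp (b i). d i v = (\<lambda>_. 0)} = d (i + 1) ` vsp (b (i + 1))"
    using res unfolding minimal_graded_free_resolution_def fmod_eq by (elim conjE)
  then show ?thesis using assms by (simp add: zero_fun_def)
qed

lemma d_d: "1 \<le> i \<Longrightarrow> v \<in> vsp (b (i + 1)) \<Longrightarrow> d i (d (i + 1) v) = 0"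
  using exact[of i] by blast

lemma boundary:
  assumes "1 \<le> i" "v \<in> vsp (b i)" "d i v = 0"
  obtains u where "u \<in> vsp (b (i + 1))" "v = d (i + 1) u"
  using exact[OF assms(1)] assms(2,3) by blast

lemma d_vsp: "d i v \<in> vsp (b (i - 1))"
  by (rule dmap_vsp)

lemmas d_lin = dmap_lin[of b _ D]
lemmas d_plus = lin_plus[OF dmap_lin[of b _ D]]
  and d_minus = lin_minus2[OF dmap_lin[of b _ D]]
  and d_smul = lin_smul[OF dmap_lin[of b _ D]]

lemma d_ordge_1: "1 \<le> i \<Longrightarrow> r < b (i - 1) \<Longrightarrow> ordge 1 (d i v r)"
proof -
  assume i: "1 \<le> i" and r: "r < b (i - 1)"
  have "ordge 1 (D i r c * v c)" if "c < b i" for c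
    using ordge_mult[OF minimal[OF i r that] ordge_0, of "v c"] by simp
  then have "ordge 1 (\<Sum>c<b i. D i r c * v c)" by (auto intro: ordge_sum)
  then show ?thesis using i r by (simp add: dmap_def)
qed

text \<open>A zero column would make \<open>ev c\<close> a cycle, hence by exactness a boundary.
  Minimality puts all coordinates of a boundary into the maximal ideal, but one coordinate of
  \<open>ev c\<close> is 1.\<close>

lemma column_nonzero:
  assumes "1 \<le> i" "c < b i"
  shows "\<exists>r<b (i - 1). D i r c \<noteq> 0"
proof (rule ccontr)
  assume *: "\<not> ?thesis"
  have "d i (ev c) = 0"
  proof
    fix r
    show "d i (ev c) r = 0 r"
    proof (cases "r < b (i - 1)")
      case True
      then show ?thesis using * assms by (simp add: dmap_ev)
    next
      case False
      then show ?thesis using d_vsp[of i "ev c"] by (simp add: vsp_def)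
    qed
  qed
  then obtain u where "ev c = d (i + 1) u"
    using boundary assms ev_vsp by metis
  then have "ordge 1 (ev c c :: ('v, 'k) mpoly)" using d_ordge_1[of "i + 1" c u] assms by simp
  then show False by (simp add: ev_def ordge_1_iff)
qed

section \<open>Filtration by total degree\<close>

text \<open>A term of \<open>a j\<close> is counted with the degree of its basis element added.
  Truncated subtraction expresses that basis elements of degree at least \<open>t\<close> impose no
  condition.\<close>

definition filt :: "nat \<Rightarrow> nat \<Rightarrow> (nat \<Rightarrow> ('v, 'k) mpoly) set" where
  "filt i t = {a \<in> vsp (b i). \<forall>j<b i. ordge (t - deg i j) (a j)}"

definition gens :: "nat \<Rightarrow> nat \<Rightarrow> bool" where
  "gens i t \<longleftrightarrow> (\<forall>j<b i. t \<le> deg i j)"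

lemma filt_vsp: "a \<in> filt i t \<Longrightarrow> a \<in> vsp (b i)"
  by (simp add: filt_def)

lemma filt_gens: "gens i t \<Longrightarrow> a \<in> vsp (b i) \<Longrightarrow> a \<in> filt i t"
  by (auto simp: filt_def gens_def)

lemma filt_zero: "0 \<in> filt i t"
  by (simp add: filt_def)

lemma filt_add: "a \<in> filt i t \<Longrightarrow> c \<in> filt i t \<Longrightarrow> a + c \<in> filt i t"
  by (simp add: filt_def vsp_add ordge_add)

lemma filt_diff: "a \<in> filt i t \<Longrightarrow> c \<in> filt i t \<Longrightarrow> a - c \<in> filt i t"
  by (simp add: filt_def vsp_diff ordge_diff)

lemma filt_sum: "(\<And>x. x \<in> A \<Longrightarrow> f x \<in> filt i t) \<Longrightarrow> sum f A \<in> filt i t"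
  by (induction A rule: infinite_finite_induct) (auto simp: filt_zero filt_add)

lemma filt_smul:
  assumes "ordge k s" "a \<in> filt i t" "t' \<le> k + t"
  shows "smul s a \<in> filt i t'"
proof -
  have "ordge (t' - deg i j) (s * a j)" if "j < b i" for j
  proof (rule ordge_mono)
    show "ordge (k + (t - deg i j)) (s * a j)"
      using assms that by (intro ordge_mult) (auto simp: filt_def)
  qed (use assms(3) in simp)
  then show ?thesis using assms(2) by (simp add: filt_def vsp_smul)
qed

lemma entry_ordge:
  assumes "1 \<le> i" "r < b (i - 1)" "c < b i"
  shows "ordge (deg i c - deg (i - 1) r) (D i r c)"
  unfolding ordge_def using homogeneous[OF assms] by force

lemma filt_d:
  assumes "1 \<le> i" "a \<in> filt i t"
  shows "d i a \<in> filt (i - 1) t"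
proof -
  have "ordge (t - deg (i - 1) r) (d i a r)" if r: "r < b (i - 1)" for r
  proof -
    have "ordge (t - deg (i - 1) r) (D i r c * a c)" if c: "c < b i" for c
    proof (rule ordge_mono)
      show "ordge ((deg i c - deg (i - 1) r) + (t - deg i c)) (D i r c * a c)"
        using assms c r by (intro ordge_mult entry_ordge) (auto simp: filt_def)
    qed simp
    then show ?thesis using assms r by (auto simp: dmap_def intro!: ordge_sum)
  qed
  then show ?thesis by (simp add: filt_def d_vsp)
qed

text \<open>The terms of \<open>a\<close> below degree \<open>t\<close> form a vector
  \<open>low\<close>. As the differential is homogeneous, \<open>d i low\<close> lives below degree
  \<open>t\<close> and also lies in \<open>filt (i - 1) t\<close>, so it vanishes. By exactness
  \<open>low\<close> is a boundary from a module generated in degrees at least \<open>t\<close>.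
  This partial converse of \<open>filt_d\<close> is how the Leibniz rule controls products.\<close>

lemma filt_reflect:
  assumes i: "1 \<le> i" and a: "a \<in> vsp (b i)" and da: "d i a \<in> filt (i - 1) t" and gens: "gens (i + 1) t"
  shows "a \<in> filt i t"
proof -
  define low where
    "low = (\<lambda>j. Poly_Mapping.mapp (\<lambda>m c. if tdeg m < t - deg i j then c else 0) (a j))"
  have lookup_low: "lookup (low j) m = (if tdeg m < t - deg i j then lookup (a j) m else 0)" for j m
    by (simp add: low_def lookup_mapp when_def in_keys_iff)
  have low: "low \<in> vsp (b i)"
    using a by (auto simp: vsp_def intro!: poly_mapping_eqI simp: lookup_low)
  have high: "a - low \<in> filt i t"
    using vsp_diff[OF a low] by (simp add: filt_def ordge_iff lookup_minus lookup_low)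
  have dlow: "d i low \<in> filt (i - 1) t"
    using filt_diff[OF da filt_d[OF i high]] d_minus[OF a low] by simp
  have "d i low = 0"
  proof
    fix r
    show "d i low r = 0 r"
    proof (cases "r < b (i - 1)")
      case True
      have "lookup (d i low r) m = 0" for m
      proof (cases "tdeg m < t - deg (i - 1) r")
        case m: True
        then show ?thesis using dlow True by (simp add: filt_def ordge_iff)
      next
        case m: False
        \<comment> \<open>With \<open>deg (i - 1) r\<close> added, every monomial of this product
          has degree below \<open>t\<close>, whereas \<open>m\<close> has degree at least
          \<open>t\<close>.\<close>
        have "lookup (D i r c * low c) m = 0" if c: "c < b i" for c
        proof (rule ccontr)
          assume "lookup (D i r c * low c) m \<noteq> 0"
          then have "m \<in> keys (D i r c * low c)" by (simp add: in_keys_iff)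
          then obtain m1 m2 where ms: "m = m1 + m2" "m1 \<in> keys (D i r c)" "m2 \<in> keys (low c)"
            using keys_mult by blast
          then have "tdeg m1 + deg (i - 1) r = deg i c" using homogeneous i True c by blast
          moreover have "tdeg m2 < t - deg i c"
            using ms(3) lookup_low by (metis in_keys_iff)
          ultimately show False using m ms(1) by (simp add: tdeg_add)
        qed
        then show ?thesis using i True by (simp add: dmap_def lookup_sum)
      qed
      then show ?thesis by (simp add: poly_mapping_eqI)
    next
      case False
      then show ?thesis using d_vsp[of i low] by (simp add: vsp_def)
    qed
  qed
  then obtain u where "u \<in> vsp (b (i + 1))" "low = d (i + 1) u"
    using boundary i low by blast
  then have "low \<in> filt i t"
    using filt_d[of "i + 1" u t] filt_gens[OF gens] by simp
  then show ?thesis using filt_add[OF high] by fastforce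
qed

text \<open>By minimality a nonzero entry in the column of a generator has positive degree, and
  homogeneity places the generator strictly above some generator of the preceding module.\<close>

lemma gens_Suc:
  assumes "gens i t" shows "gens (i + 1) (t + 1)"
  unfolding gens_def Suc_eq_plus1[symmetric]
proof (intro allI impI)
  fix c assume c: "c < b (Suc i)"
  then obtain r where r: "r < b i" "D (Suc i) r c \<noteq> 0"
    using column_nonzero[of "Suc i" c] by auto
  then obtain m where m: "m \<in> keys (D (Suc i) r c)" by fastforce
  have "1 \<le> tdeg m" using minimal[of "Suc i" r c] m r c by (auto simp: ordge_def)
  moreover have "tdeg m + deg i r = deg (Suc i) c" using homogeneous[of "Suc i" r c m] m r c by simp
  ultimately show "Suc t \<le> deg (Suc i) c" using assms r(1) by (auto simp: gens_def)
qed

lemma gens_mono: "gens i t \<Longrightarrow> t' \<le> t \<Longrightarrow> gens i t'"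
  by (auto simp: gens_def)

end

section \<open>Cycle graphs and their edge ideals\<close>

text \<open>An edge ideal is a monomial ideal. Only positivity of the two exponents is recorded,
  which amounts to divisibility by the edge monomial when there are no loops.\<close>

lemma keys_edge_ideal:
  assumes "p \<in> edge_ideal E" "m \<in> keys p"
  obtains u w where "E u w" "lookup m u \<noteq> 0" "lookup m w \<noteq> 0"
proof -
  obtain c where p: "p = (\<Sum>e\<in>{(u, w). E u w}. c e * Var (fst e) * Var (snd e))"
    using assms(1) by (auto simp: edge_ideal_def)
  have "lookup p m \<noteq> 0" using assms(2) by (simp add: in_keys_iff)
  then obtain e where e: "e \<in> {(u, w). E u w}" "lookup (c e * Var (fst e) * Var (snd e)) m \<noteq> 0"
    unfolding p lookup_sum by (meson sum.not_neutral_contains_not_neutral)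
  have "lookup (Var (fst e) * (c e * Var (snd e))) m \<noteq> 0"
    and "lookup (Var (snd e) * (c e * Var (fst e))) m \<noteq> 0"
    using e(2) by (simp_all add: mult_ac)
  then have "lookup m (fst e) \<noteq> 0" "lookup m (snd e) \<noteq> 0"
    using lookup_Var_mult_eq_0 by metis+
  with e(1) that show thesis by auto
qed

lemma edge_in_ideal:
  assumes "E u w" shows "p * (Var u * Var w) \<in> edge_ideal E"
proof -
  define c where "c = (\<lambda>e. if e = (u, w) then p else 0)"
  have "(\<Sum>e\<in>{(u, w). E u w}. c e * Var (fst e) * Var (snd e))
      = (\<Sum>e\<in>{(u, w). E u w}. if (u, w) = e then p * (Var u * Var w) else 0)"
    by (intro sum.cong) (auto simp: c_def algebra_simps)
  also have "\<dots> = p * (Var u * Var w)" using assms by simp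
  finally show ?thesis unfolding edge_ideal_def by (intro CollectI exI[of _ c]) simp
qed

lemma edge_ideal_add:
  assumes "p \<in> edge_ideal E" "q \<in> edge_ideal E" shows "p + q \<in> edge_ideal E"
proof -
  obtain c c' where "p = (\<Sum>e\<in>{(u, w). E u w}. c e * Var (fst e) * Var (snd e))"
    "q = (\<Sum>e\<in>{(u, w). E u w}. c' e * Var (fst e) * Var (snd e))"
    using assms by (auto simp: edge_ideal_def)
  then have "p + q = (\<Sum>e\<in>{(u, w). E u w}. (c e + c' e) * Var (fst e) * Var (snd e))"
    by (simp add: sum.distrib algebra_simps)
  then show ?thesis unfolding edge_ideal_def by (intro CollectI exI[of _ "\<lambda>e. c e + c' e"]) simp
qed

lemma zero_edge_ideal: "0 \<in> edge_ideal E"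
  unfolding edge_ideal_def by (rule CollectI, rule exI[of _ "\<lambda>_. 0"]) simp

locale cycle_graph =
  fixes E :: "'v::finite \<Rightarrow> 'v \<Rightarrow> bool" and f :: "nat \<Rightarrow> 'v" and n :: nat
  assumes n_def: "n = card (UNIV :: 'v set)" and n3: "3 \<le> n"
    and bij: "bij_betw f {..<n} UNIV"
    and E_iff: "\<And>u w. E u w \<longleftrightarrow> (\<exists>i<n. {u, w} = {f i, f ((i + 1) mod n)})"
begin

text \<open>Indices are read modulo \<open>n\<close>, so shifts such as \<open>i + 2\<close> need no
  wrap-around.\<close>

definition X :: "nat \<Rightarrow> ('v, 'k::field) mpoly" where
  "X i = Var (f (i mod n))"

lemma f_eq_iff: "i < n \<Longrightarrow> j < n \<Longrightarrow> f i = f j \<longleftrightarrow> i = j"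
  using bij by (auto simp: bij_betw_def inj_on_def)

lemma f_surj: obtains i where "i < n" "u = f i"
  using bij unfolding bij_betw_def by (metis UNIV_I imageE lessThan_iff)

text \<open>The cyclic successor is written as a conditional, so that adjacency questions become
  case splits with linear arithmetic.\<close>

lemma E_f:
  assumes "i < n" "j < n"
  shows "E (f i) (f j) \<longleftrightarrow> j = (if i + 1 = n then 0 else i + 1) \<or> i = (if j + 1 = n then 0 else j + 1)"
proof -
  have s: "(k + 1) mod n = (if k + 1 = n then 0 else k + 1)" "(k + 1) mod n < n" if "k < n" for k
    using that by auto
  have "{f i, f j} = {f k, f ((k + 1) mod n)}
      \<longleftrightarrow> (i = k \<and> j = (k + 1) mod n) \<or> (j = k \<and> i = (k + 1) mod n)" if "k < n" for k
    unfolding doubleton_eq_iff using that assms f_eq_iff s(2) by metis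
  then have "E (f i) (f j) \<longleftrightarrow> (\<exists>k<n. (i = k \<and> j = (k + 1) mod n) \<or> (j = k \<and> i = (k + 1) mod n))"
    unfolding E_iff by blast
  also have "\<dots> \<longleftrightarrow> j = (i + 1) mod n \<or> i = (j + 1) mod n"
    using assms by blast
  finally show ?thesis using assms s(1) by simp
qed

lemma E_sym: "E u w \<Longrightarrow> E w u"
  by (auto simp: E_iff insert_commute)

lemma E_irrefl: "\<not> E u u"
proof
  assume E: "E u u"
  obtain i where "i < n" "u = f i" by (rule f_surj)
  then show False using E E_f[of i i] n3 by (auto split: if_splits)
qed

lemma E_degree:
  assumes "E a u" "E a v" "E a w" "u \<noteq> v" "u \<noteq> w" shows "v = w"
proof -
  obtain i j k l where "i < n" "j < n" "k < n" "l < n" "a = f i" "u = f j" "v = f k" "w = f l"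
    by (metis f_surj)
  then show ?thesis using assms by (auto simp: E_f f_eq_iff split: if_splits)
qed

lemma no_triangle:
  assumes "E u v" "E v w" "E w u" shows "n = 3"
proof -
  obtain i j k where "i < n" "j < n" "k < n" "u = f i" "v = f j" "w = f k"
    by (metis f_surj)
  then show ?thesis using assms n3 by (auto simp: E_f f_eq_iff split: if_splits)
qed

lemma no_square:
  assumes "E u v" "E v w" "E w x" "E x u" "u \<noteq> w" "v \<noteq> x" shows "n = 4"
proof -
  obtain i j k l where n: "i < n" "j < n" "k < n" "l < n" and eq: "u = f i" "v = f j" "w = f k" "x = f l"
    by (metis f_surj)
  \<comment> \<open>\<open>s\<close> is the cyclic successor. Opposite corners have the same two
    neighbours, one as successor and one as predecessor; following \<open>s\<close> round the square
    gives \<open>s (s (s (s i))) = i\<close>, which forces \<open>n = 4\<close>.\<close>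
  define s where "s = (\<lambda>k. if k + 1 = n then 0 else k + 1)"
  have s_inj: "p = q" if "s p = s q" "p < n" "q < n" for p q
    using that by (auto simp: s_def split: if_splits)
  have four: "n = 4" if "s (s (s (s p))) = p" "p < n" for p
    using that n3 by (auto simp: s_def split: if_splits)
  have E: "E (f p) (f q) \<longleftrightarrow> q = s p \<or> p = s q" if "p < n" "q < n" for p q
    using E_f[OF that] by (simp add: s_def)
  have ne: "i \<noteq> k" "j \<noteq> l" using assms(5,6) eq by auto
  have i: "j = s i \<and> i = s l \<or> l = s i \<and> i = s j"
    using assms(1,4) eq n ne E s_inj by metis
  have k: "j = s k \<and> k = s l \<or> l = s k \<and> k = s j"
    using assms(2,3) eq n ne E s_inj by metis
  from i k show ?thesis using ne n s_inj four by metis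
qed

lemma edge_monomial:
  assumes "E u w"
  obtains i where "i < n" "Var u * Var w = X i * X (i + 1)"
proof -
  obtain i where i: "i < n" and uw: "{u, w} = {f i, f ((i + 1) mod n)}"
    using assms by (auto simp: E_iff)
  have "Var u * Var w = Var (f i) * Var (f ((i + 1) mod n))"
    using uw unfolding doubleton_eq_iff by (auto simp: mult.commute)
  with i that show thesis by (auto simp: X_def)
qed

lemma X_edge: "E (f (i mod n)) (f ((i + 1) mod n))"
proof -
  have "i mod n < n" using n3 by simp
  then show ?thesis unfolding E_iff by (intro exI[of _ "i mod n"]) (simp add: mod_add_left_eq)
qed

text \<open>The definition sums over ordered pairs, so every edge contributes twice; grouping the
  pairs by the index of their edge adds the coefficients of both orientations.\<close>

lemma edge_ideal_eq:
  "edge_ideal E = {\<Sum>i<n. a i * (X i * X (i + 1) :: ('v, 'k::field) mpoly) | a. True}"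
proof (intro equalityI subsetI)
  fix p :: "('v, 'k) mpoly"
  assume "p \<in> edge_ideal E"
  then obtain c where p: "p = (\<Sum>e\<in>{(u, w). E u w}. c e * Var (fst e) * Var (snd e))"
    by (auto simp: edge_ideal_def)
  have "\<forall>e. \<exists>i. e \<in> {(u, w). E u w} \<longrightarrow> i < n \<and> Var (fst e) * Var (snd e) = (X i * X (i + 1) :: ('v, 'k) mpoly)"
    using edge_monomial by (metis case_prodE fst_conv mem_Collect_eq snd_conv)
  then obtain h where h: "\<And>e. e \<in> {(u, w). E u w} \<Longrightarrow>
      h e < n \<and> Var (fst e) * Var (snd e) = (X (h e) * X (h e + 1) :: ('v, 'k) mpoly)" by metis
  let ?S = "{(u, w). E u w}"
  have "p = (\<Sum>e\<in>?S. c e * (X (h e) * X (h e + 1)))"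
    unfolding p using h by (intro sum.cong) (auto simp: mult.assoc)
  also have "\<dots> = (\<Sum>i<n. \<Sum>e\<in>{e \<in> ?S. h e = i}. c e * (X (h e) * X (h e + 1)))"
    using h by (subst sum.group) auto
  also have "\<dots> = (\<Sum>i<n. (\<Sum>e\<in>{e \<in> ?S. h e = i}. c e) * (X i * X (i + 1)))"
    by (intro sum.cong) (auto simp: sum_distrib_right)
  finally show "p \<in> {\<Sum>i<n. a i * (X i * X (i + 1)) | a. True}"
    by (intro CollectI exI[of _ "\<lambda>i. \<Sum>e\<in>{e \<in> ?S. h e = i}. c e"]) simp
next
  fix p :: "('v, 'k) mpoly"
  assume "p \<in> {\<Sum>i<n. a i * (X i * X (i + 1)) | a. True}"
  then obtain a where p: "p = (\<Sum>i<n. a i * (X i * X (i + 1)))" by blast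
  have "(\<Sum>i\<in>A. a i * (X i * X (i + 1))) \<in> edge_ideal E" for A
    by (induction A rule: infinite_finite_induct)
      (auto simp: zero_edge_ideal X_def intro!: edge_ideal_add edge_in_ideal X_edge)
  then show "p \<in> edge_ideal E" unfolding p .
qed

lemma ordge_edge_ideal:
  assumes "p \<in> edge_ideal E" shows "ordge 2 p"
  unfolding ordge_def
proof
  fix m assume "m \<in> keys p"
  then obtain u w where uw: "E u w" "lookup m u \<noteq> 0" "lookup m w \<noteq> 0"
    using assms keys_edge_ideal by metis
  have "u \<noteq> w" using uw(1) E_irrefl by blast
  then have "lookup m u + lookup m w = (\<Sum>v\<in>{u, w}. lookup m v)" by simp
  also have "\<dots> \<le> tdeg m" unfolding tdeg_def by (rule sum_mono2) auto
  finally show "2 \<le> tdeg m" using uw by simp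
qed

end

section \<open>Low degree generators\<close>

abbreviation xm :: "'v \<Rightarrow> 'v \<Rightarrow>\<^sub>0 nat" where "xm v \<equiv> Poly_Mapping.single v 1"

lemma lookup_xm: "lookup (xm v) w = (if v = w then 1 else 0)"
  by (simp add: lookup_single when_def)

lemma xm_eq_iff [simp]: "xm v = xm w \<longleftrightarrow> v = w"
  by (metis lookup_xm zero_neq_one)

lemma tdeg_1_cases:
  assumes "tdeg m = 1" obtains v where "m = xm v"
proof -
  have "(\<Sum>v\<in>UNIV. lookup m v) = 1" using assms by (simp add: tdeg_def)
  then obtain v where v: "lookup m v = 1" "\<And>w. w \<noteq> v \<Longrightarrow> lookup m w = 0"
    unfolding sum_eq_1_iff[OF finite_UNIV] by (metis UNIV_I)
  then have "m = xm v"
    by (intro poly_mapping_eqI) (auto simp: lookup_xm)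
  then show thesis by (rule that)
qed

lemma tdeg_2_cases:
  assumes "tdeg m = 2" "lookup m u \<noteq> 0" "lookup m w \<noteq> 0" "u \<noteq> w"
  shows "m = xm u + xm w"
proof -
  have "m = (m - xm u - xm w) + (xm u + xm w)"
    using assms(2-4) by (intro poly_mapping_eqI) (auto simp: lookup_add lookup_minus lookup_xm)
  moreover from this have "tdeg (m - xm u - xm w) = 0"
    using assms(1) by (metis tdeg_add tdeg_single add_cancel_left_left one_add_one)
  ultimately show ?thesis by (simp add: tdeg_eq_0_iff)
qed

lemma linear_form:
  fixes p :: "('v::finite, 'k::field) mpoly"
  assumes "\<And>m. m \<in> keys p \<Longrightarrow> tdeg m = 1"
  shows "p = (\<Sum>u\<in>UNIV. Var u * Poly_Mapping.single 0 (lookup p (xm u)))"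
proof (rule poly_mapping_eqI)
  fix m
  have *: "(\<Sum>u\<in>UNIV. Var u * Poly_Mapping.single 0 (lookup p (xm u)))
      = (\<Sum>u\<in>UNIV. Poly_Mapping.single (xm u) (lookup p (xm u)))"
    by (simp add: Var_def mult_single)
  show "lookup p m = lookup (\<Sum>u\<in>UNIV. Var u * Poly_Mapping.single 0 (lookup p (xm u))) m"
  proof (cases "tdeg m = 1")
    case True
    then obtain v where m: "m = xm v" by (rule tdeg_1_cases)
    have "(\<Sum>u\<in>UNIV. lookup (Poly_Mapping.single (xm u) (lookup p (xm u))) (xm v))
        = (\<Sum>u\<in>UNIV. if v = u then lookup p (xm u) else 0)"
      by (intro sum.cong) (auto simp: lookup_single when_def)
    then show ?thesis unfolding * lookup_sum m by simp
  next
    case False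
    then have "xm u \<noteq> m" for u by auto
    then have "lookup (Poly_Mapping.single (xm u) c) m = (0 :: 'k)" for u c
      by (simp add: lookup_single when_def)
    then show ?thesis unfolding * lookup_sum using False assms by (auto simp: in_keys_iff)
  qed
qed

context cycle_graph begin

text \<open>The family \<open>p\<close> is an element of the kernel of \<open>\<Lambda>\<^sup>2 Q\<^sub>1 \<otimes> I\<^sub>2 \<rightarrow> Q\<^sub>1 \<otimes> I\<^sub>3\<close>;
  this Koszul homology is the space of generators of degree 4 of \<open>F\<^sub>3\<close>.\<close>

lemma no_linear_second_syzygies:
  fixes p :: "'v \<Rightarrow> 'v \<Rightarrow> ('v, 'k::field) mpoly"
  assumes n5: "5 \<le> n" and ideal: "\<And>u v. p u v \<in> edge_ideal E"
    and quadric: "\<And>u v m. m \<in> keys (p u v) \<Longrightarrow> tdeg m = 2"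
    and anti: "\<And>u v. p u v = - p v u" and diag: "\<And>v. p v v = 0"
    and rel: "\<And>v. (\<Sum>u\<in>UNIV. Var u * p u v) = 0"
  shows "p u v = 0"
proof -
  define c where "c = (\<lambda>u v a b. lookup (p u v) (xm a + xm b))"
  have c_sym: "c u v a b = c u v b a" for u v a b by (simp add: c_def add.commute)
  have c_anti: "c u v a b = - c v u a b" for u v a b unfolding c_def by (subst anti) simp
  have c_edge: "E a b" if "c u v a b \<noteq> 0" for u v a b
  proof -
    from that have "xm a + xm b \<in> keys (p u v)" by (simp add: c_def in_keys_iff)
    then obtain x y where xy: "E x y" "lookup (xm a + xm b) x \<noteq> 0" "lookup (xm a + xm b) y \<noteq> 0"
      using ideal keys_edge_ideal by metis
    have "x \<noteq> y" using xy(1) E_irrefl by blast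
    then show "E a b" using xy E_sym by (auto simp: lookup_add lookup_xm split: if_splits)
  qed
  have rel_lookup: "(\<Sum>w\<in>UNIV. lookup (Var w * p w v) m) = 0" for v m
    using arg_cong[OF rel[of v], of "\<lambda>q. lookup q m"] by (simp add: lookup_sum)
  have summand: "lookup (Var w * p w v) (xm w + (xm x + xm y)) = c w v x y" for w v x y
    unfolding c_def by (rule lookup_Var_mult)
  \<comment> \<open>Coefficient of the squarefree monomial in \<open>u\<close>, \<open>a\<close>,
    \<open>b\<close> in \<open>rel\<close>.\<close>
  have rel3: "c u v a b + c a v u b + c b v u a = 0" if "u \<noteq> a" "u \<noteq> b" "a \<noteq> b" for u v a b
  proof -
    define m where "m = xm u + (xm a + xm b)"
    have m': "m = xm a + (xm u + xm b)" "m = xm b + (xm u + xm a)"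
      unfolding m_def by (simp_all only: ac_simps)
    have "0 = (\<Sum>w\<in>{u, a, b}. lookup (Var w * p w v) m)"
      unfolding rel_lookup[of v m, symmetric]
      by (intro sum.mono_neutral_right) (auto intro!: lookup_Var_mult_eq_0 simp: m_def lookup_add lookup_xm split: if_splits)
    also have "\<dots> = lookup (Var u * p u v) m + lookup (Var a * p a v) m + lookup (Var b * p b v) m"
      using that by (simp add: add.assoc)
    also have "lookup (Var u * p u v) m = c u v a b" unfolding m_def by (rule summand)
    also have "lookup (Var a * p a v) m = c a v u b" unfolding m'(1) by (rule summand)
    also have "lookup (Var b * p b v) m = c b v u a" unfolding m'(2) by (rule summand)
    finally show ?thesis by simp
  qed
  \<comment> \<open>Coefficient of the square of \<open>a\<close> times \<open>b\<close>; the
    contribution \<open>c b v a a\<close> vanishes because the graph has no loops.\<close>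
  have rel2: "c a v a b = 0" if "a \<noteq> b" for a b v
  proof -
    define m where "m = xm a + (xm a + xm b)"
    have m': "m = xm b + (xm a + xm a)"
      unfolding m_def by (simp only: ac_simps)
    have "0 = (\<Sum>w\<in>{a, b}. lookup (Var w * p w v) m)"
      unfolding rel_lookup[of v m, symmetric]
      by (intro sum.mono_neutral_right) (auto intro!: lookup_Var_mult_eq_0 simp: m_def lookup_add lookup_xm split: if_splits)
    also have "\<dots> = lookup (Var a * p a v) m + lookup (Var b * p b v) m"
      using that by simp
    also have "lookup (Var a * p a v) m = c a v a b" unfolding m_def by (rule summand)
    also have "lookup (Var b * p b v) m = c b v a a" unfolding m' by (rule summand)
    finally have "c a v a b + c b v a a = 0" by simp
    moreover have "c b v a a = 0" using c_edge E_irrefl by metis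
    ultimately show ?thesis by simp
  qed
  have incident: "c u v a b = 0" if "u = a \<or> u = b \<or> v = a \<or> v = b" "a \<noteq> b" for u v a b
    using that rel2 c_sym c_anti by (metis neg_equal_0_iff_equal)
  have far: "c u v a b = 0" if "\<not> E u a" "\<not> E u b" for u v a b
  proof (cases "u = a \<or> u = b \<or> a = b")
    case True
    then show ?thesis using incident c_edge E_irrefl by metis
  next
    case False
    then have "c u v a b + c a v u b + c b v u a = 0" by (intro rel3) auto
    moreover have "c a v u b = 0" "c b v u a = 0" using that c_edge by blast+
    ultimately show ?thesis by simp
  qed
  \<comment> \<open>If the coefficient were nonzero, \<open>v\<close> would be adjacent to
    \<open>b\<close>, as otherwise \<open>far\<close> applies to \<open>v\<close>, but not to
    \<open>a\<close>, which already has the neighbours \<open>u\<close> and \<open>b\<close>.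
    Excluding triangles and four-cycles, neither \<open>b\<close> nor \<open>v\<close> is adjacent
    to \<open>u\<close>, so the other two terms of \<open>rel3\<close> vanish.\<close>
  have near: "c u v a b = 0" if ua: "E u a" and ne: "u \<noteq> b" "v \<noteq> a" "v \<noteq> b" "u \<noteq> v" for u v a b
  proof (rule ccontr)
    assume nz: "c u v a b \<noteq> 0"
    then have ab: "E a b" by (rule c_edge)
    have "u \<noteq> a" "a \<noteq> b" using ua ab E_irrefl by auto
    have ub: "\<not> E u b" using no_triangle[OF ua ab] E_sym n5 by auto
    have va: "\<not> E v a"
    proof
      assume "E v a"
      then show False using E_degree[of a b u v] ua ab ne E_sym by metis
    qed
    have "E v b" using far[of v a b u] va nz c_anti[of u v a b] by fastforce
    have "\<not> E v u"
    proof
      assume "E v u"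
      then have "n = 4" using no_square[OF _ ua ab, of v] E_sym[OF \<open>E v b\<close>] ne by blast
      then show False using n5 by simp
    qed
    then have "c v b u a = 0" using va by (intro far)
    then have "c b v u a = 0" using c_anti by (metis neg_equal_0_iff_equal)
    moreover have "c a v u b = 0" using ub c_edge by blast
    moreover have "c u v a b + c a v u b + c b v u a = 0"
      using \<open>u \<noteq> a\<close> \<open>a \<noteq> b\<close> ne(1) by (intro rel3)
    ultimately show False using nz by simp
  qed
  have all: "c u v a b = 0" for u v a b
  proof (cases "a = b \<or> u = v \<or> u = a \<or> u = b \<or> v = a \<or> v = b")
    case True
    then show ?thesis using incident c_edge E_irrefl diag unfolding c_def by (metis lookup_zero)
  next
    case False
    then show ?thesis using far near c_sym by metis
  qed
  have "m \<notin> keys (p u v)" for m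
  proof
    assume m: "m \<in> keys (p u v)"
    then obtain a b where ab: "E a b" "lookup m a \<noteq> 0" "lookup m b \<noteq> 0"
      using ideal keys_edge_ideal by metis
    then have "m = xm a + xm b" using quadric[OF m] E_irrefl by (intro tdeg_2_cases) auto
    then show False using m all[of u v a b] by (simp add: c_def in_keys_iff)
  qed
  then show ?thesis by (metis all_not_in_conv keys_eq_empty)
qed

end

declare One_nat_def [symmetric, simp]

abbreviation Cst :: "'k \<Rightarrow> ('v, 'k::field) mpoly" where "Cst \<equiv> Poly_Mapping.single 0"

text \<open>Koszul relations in lowest degree: the linear coefficients of a relation among the
  variables form an alternating matrix. The zero diagonal is a separate claim because it does not
  follow from skew-symmetry in characteristic 2.\<close>

lemma lookup_linear_combination:
  fixes q :: "'v::finite \<Rightarrow> ('v, 'k::field) mpoly"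
  assumes q: "(\<Sum>v\<in>UNIV. Var v * q v) = 0"
  shows "lookup (q u) (xm u) = 0"
    and "u \<noteq> w \<Longrightarrow> lookup (q u) (xm w) + lookup (q w) (xm u) = 0"
proof -
  have *: "(\<Sum>v\<in>UNIV. lookup (Var v * q v) m) = 0" for m
    using arg_cong[OF q, of "\<lambda>q. lookup q m"] by (simp add: lookup_sum)
  have "0 = (\<Sum>v\<in>{u}. lookup (Var v * q v) (xm u + xm u))"
    unfolding *[of "xm u + xm u", symmetric]
    by (intro sum.mono_neutral_right) (auto intro!: lookup_Var_mult_eq_0 simp: lookup_add lookup_xm split: if_splits)
  then show "lookup (q u) (xm u) = 0" by (simp add: lookup_Var_mult)
  assume "u \<noteq> w"
  have "0 = (\<Sum>v\<in>{u, w}. lookup (Var v * q v) (xm u + xm w))"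
    unfolding *[of "xm u + xm w", symmetric]
    by (intro sum.mono_neutral_right) (auto intro!: lookup_Var_mult_eq_0 simp: lookup_add lookup_xm split: if_splits)
  also have "\<dots> = lookup (Var u * q u) (xm u + xm w) + lookup (Var w * q w) (xm w + xm u)"
    using \<open>u \<noteq> w\<close> by (simp add: add.commute)
  finally show "lookup (q u) (xm w) + lookup (q w) (xm u) = 0"
    by (simp only: lookup_Var_mult)
qed

locale cycle_resolution = cycle_graph E f n + minimal_resolution "edge_ideal E" b deg D
  for E :: "'v::finite \<Rightarrow> 'v \<Rightarrow> bool" and f n b deg
  and D :: "nat \<Rightarrow> nat \<Rightarrow> nat \<Rightarrow> ('v, 'k::field) mpoly"
begin

lemma d1_ordge: "v \<in> vsp (b 1) \<Longrightarrow> ordge 2 (d 1 v 0)"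
  using d1_in_ideal ordge_edge_ideal by blast

lemma gens_1: "gens 1 2"
  unfolding gens_def
proof (intro allI impI)
  fix c assume c: "c < b 1"
  then obtain r where "r < b 0" "D 1 r c \<noteq> 0" using column_nonzero[of 1 c] by auto
  then have D: "D 1 0 c \<noteq> 0" using b_0 by simp
  then obtain m where m: "m \<in> keys (D 1 0 c)" by (metis all_not_in_conv keys_eq_empty)
  have "D 1 0 c = d 1 (ev c) 0" using dmap_ev[of 1 c b 0 D] c b_0 by simp
  then have "2 \<le> tdeg m" using d1_ordge[OF ev_vsp[OF c]] m by (simp add: ordge_def)
  moreover have "tdeg m + deg 0 0 = deg 1 c" using homogeneous[of 1 0 c m] m c b_0 by simp
  ultimately show "2 \<le> deg 1 c" by simp
qed

lemma gens_2: "gens 2 3"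
  using gens_Suc[OF gens_1] by simp

lemma gens_3_weak: "gens 3 4"
  using gens_Suc[OF gens_2] by simp

text \<open>A generator of degree 4 would have a column of linear forms. Expanding it twice along
  the variables gives constant vectors \<open>y u v\<close>, alternating in \<open>u\<close> and
  \<open>v\<close>, whose boundaries satisfy the hypotheses of
  \<open>no_linear_second_syzygies\<close>. They therefore vanish, and with them the column, against
  \<open>column_nonzero\<close>.\<close>

lemma gens_3:
  assumes n5: "5 \<le> n" shows "gens 3 5"
  unfolding gens_def
proof (intro allI impI, rule ccontr)
  fix c assume c: "c < b 3" and "\<not> 5 \<le> deg 3 c"
  with gens_3_weak have deg_c: "deg 3 c = 4" by (force simp: gens_def)
  have D3: "tdeg m = 1 \<and> deg 2 r = 3" if "r < b 2" "m \<in> keys (D 3 r c)" for r m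
  proof -
    have "tdeg m + deg 2 r = 4" using homogeneous[of 3 r c m] that c deg_c by simp
    moreover have "1 \<le> tdeg m" using minimal[of 3 r c] that c by (auto simp: ordge_def)
    moreover have "3 \<le> deg 2 r" using gens_2 that by (simp add: gens_def)
    ultimately show ?thesis by simp
  qed
  \<comment> \<open>Column \<open>c\<close> consists of linear forms in the coordinates of degree 3;
    \<open>z v\<close> collects their coefficients at the variable \<open>v\<close>.\<close>
  define z where "z = (\<lambda>v r. if r < b 2 then Cst (lookup (D 3 r c) (xm v)) else 0 :: ('v, 'k) mpoly)"
  have z_vsp: "z v \<in> vsp (b 2)" for v by (simp add: z_def vsp_def)
  have z_zero: "z v r = 0" if "deg 2 r \<noteq> 3" for v r
  proof (cases "r < b 2")
    case True
    then have "xm v \<notin> keys (D 3 r c)" using D3 that by blast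
    then show ?thesis by (simp add: z_def in_keys_iff)
  qed (simp add: z_def)
  have h: "d 3 (ev c) = (\<Sum>v\<in>UNIV. smul (Var v) (z v))"
  proof
    fix r
    show "d 3 (ev c) r = (\<Sum>v\<in>UNIV. smul (Var v) (z v)) r"
    proof (cases "r < b 2")
      case True
      then have "d 3 (ev c) r = D 3 r c" using dmap_ev[of 3 c b r D] c by simp
      also have "\<dots> = (\<Sum>v\<in>UNIV. Var v * Cst (lookup (D 3 r c) (xm v)))"
        using D3[OF True] by (intro linear_form) blast
      finally show ?thesis using True by (simp add: sum_fun_apply z_def)
    next
      case False
      then show ?thesis using d_vsp[of 3 "ev c"] by (simp add: vsp_def sum_fun_apply z_def)
    qed
  qed
  have D2: "tdeg m = 1 \<and> deg 1 s = 2" if "s < b 1" "m \<in> keys (d 2 (z v) s)" for s m v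
  proof -
    have "d 2 (z v) s = (\<Sum>r<b 2. D 2 s r * z v r)" using that by (simp add: dmap_def)
    then have "(\<Sum>r<b 2. lookup (D 2 s r * z v r) m) \<noteq> 0"
      using that(2) by (simp add: in_keys_iff lookup_sum)
    then obtain r where r: "r < b 2" "lookup (D 2 s r * z v r) m \<noteq> 0"
      by (meson lessThan_iff sum.not_neutral_contains_not_neutral)
    then have "m \<in> keys (D 2 s r * z v r)" by (simp add: in_keys_iff)
    then obtain m1 m2 where ms: "m = m1 + m2" "m1 \<in> keys (D 2 s r)" "m2 \<in> keys (z v r)"
      using keys_mult by blast
    have "m2 = 0" using ms(3) r(1) by (simp add: z_def split: if_splits)
    have "deg 2 r = 3" using z_zero[of r v] ms(3) by fastforce
    then have "tdeg m1 + deg 1 s = 3" using homogeneous[of 2 s r m1] ms(2) r(1) that(1) by simp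
    moreover have "1 \<le> tdeg m1" using minimal[of 2 s r] ms(2) r(1) that(1) by (auto simp: ordge_def)
    moreover have "2 \<le> deg 1 s" using gens_1 that by (simp add: gens_def)
    ultimately show ?thesis using ms(1) \<open>m2 = 0\<close> by simp
  qed
  \<comment> \<open>The same expansion one step further down, applied to the boundary of the
    constant vector \<open>z v\<close>.\<close>
  define y where "y = (\<lambda>u v s. if s < b 1 then Cst (lookup (d 2 (z v) s) (xm u)) else 0 :: ('v, 'k) mpoly)"
  have y_vsp: "y u v \<in> vsp (b 1)" for u v by (simp add: y_def vsp_def)
  have y_zero: "y u v s = 0" if "deg 1 s \<noteq> 2" for u v s
  proof (cases "s < b 1")
    case True
    then have "xm u \<notin> keys (d 2 (z v) s)" using D2 that by blast
    then show ?thesis by (simp add: y_def in_keys_iff)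
  qed (simp add: y_def)
  have dz: "d 2 (z v) = (\<Sum>u\<in>UNIV. smul (Var u) (y u v))" for v
  proof
    fix s
    show "d 2 (z v) s = (\<Sum>u\<in>UNIV. smul (Var u) (y u v)) s"
    proof (cases "s < b 1")
      case True
      then have "d 2 (z v) s = (\<Sum>u\<in>UNIV. Var u * Cst (lookup (d 2 (z v) s) (xm u)))"
        using D2[OF True] by (intro linear_form) blast
      then show ?thesis using True by (simp add: sum_fun_apply y_def)
    next
      case False
      then show ?thesis using d_vsp[of 2 "z v"] by (simp add: vsp_def sum_fun_apply y_def)
    qed
  qed
  \<comment> \<open>Two consecutive differentials compose to zero, so the products of two variables
    with the vectors \<open>y u v\<close> sum to zero, which makes \<open>y\<close>
    alternating.\<close>
  have "0 = d 2 (d 3 (ev c))"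
    using d_d[of 2 "ev c"] ev_vsp[OF c] by simp
  also have "\<dots> = (\<Sum>v\<in>UNIV. d 2 (smul (Var v) (z v)))"
    unfolding h by (rule lin_sum[OF d_lin]) (simp add: vsp_smul z_vsp)
  also have "\<dots> = (\<Sum>v\<in>UNIV. smul (Var v) (d 2 (z v)))"
    by (simp add: d_smul z_vsp)
  finally have "(\<Sum>v\<in>UNIV. Var v * d 2 (z v) s) = 0" for s
    by (metis (mono_tags, lifting) smul_apply sum.cong sum_fun_apply zero_fun_apply)
  note rel = lookup_linear_combination[OF this]
  have y_diag: "y v v = 0" for v
    using rel(1) by (auto simp: y_def fun_eq_iff)
  have y_anti: "y u v = - y v u" for u v
  proof (cases "u = v")
    case True
    then show ?thesis by (simp add: y_diag)
  next
    case False
    have "lookup (d 2 (z v) s) (xm u) = - lookup (d 2 (z u) s) (xm v)" for s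
      using rel(2)[of v u s] False by (simp add: eq_neg_iff_add_eq_0)
    then show ?thesis by (auto simp: y_def fun_eq_iff single_uminus)
  qed
  define p where "p = (\<lambda>u v. d 1 (y u v) 0)"
  have "p u v = 0" for u v
  proof (rule no_linear_second_syzygies[OF n5])
    show "p u v \<in> edge_ideal E" for u v unfolding p_def by (rule d1_in_ideal[OF y_vsp])
    show "p u v = - p v u" for u v
      unfolding p_def by (subst y_anti) (simp add: lin_minus[OF d_lin y_vsp])
    show "p v v = 0" for v
      unfolding p_def by (simp add: y_diag lin_zero[OF d_lin])
    show "tdeg m = 2" if "m \<in> keys (p u v)" for u v m
    proof -
      have "p u v = (\<Sum>s<b 1. D 1 0 s * y u v s)" using b_0 by (simp add: p_def dmap_def)
      then have "(\<Sum>s<b 1. lookup (D 1 0 s * y u v s) m) \<noteq> 0"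
        using that by (simp add: in_keys_iff lookup_sum)
      then obtain s where s: "s < b 1" "lookup (D 1 0 s * y u v s) m \<noteq> 0"
        by (meson lessThan_iff sum.not_neutral_contains_not_neutral)
      then have "m \<in> keys (D 1 0 s * y u v s)" by (simp add: in_keys_iff)
      then obtain m1 m2 where ms: "m = m1 + m2" "m1 \<in> keys (D 1 0 s)" "m2 \<in> keys (y u v s)"
        using keys_mult by blast
      have "m2 = 0" using ms(3) s(1) by (simp add: y_def split: if_splits)
      moreover have "deg 1 s = 2" using y_zero[of s u v] ms(3) by fastforce
      moreover have "tdeg m1 + deg 0 0 = deg 1 s" using homogeneous[of 1 0 s m1] ms(2) s(1) b_0 by simp
      ultimately show ?thesis using ms(1) deg_0 by simp
    qed
    show "(\<Sum>u\<in>UNIV. Var u * p u v) = 0" for v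
    proof -
      have "0 = d 1 (d 2 (z v))" using d_d[of 1 "z v"] z_vsp by simp
      also have "\<dots> = (\<Sum>u\<in>UNIV. d 1 (smul (Var u) (y u v)))"
        unfolding dz by (rule lin_sum[OF d_lin]) (simp add: vsp_smul y_vsp)
      also have "\<dots> = (\<Sum>u\<in>UNIV. smul (Var u) (d 1 (y u v)))"
        by (simp add: d_smul y_vsp)
      finally show ?thesis unfolding p_def
        by (metis (mono_tags, lifting) smul_apply sum.cong sum_fun_apply zero_fun_apply)
    qed
  qed
  \<comment> \<open>Now back up again: \<open>y u v\<close> is a cycle, so by
    \<open>filt_reflect\<close> it has no part in degree 2, where its entries are constants; hence
    it is zero. The same argument gives \<open>z v = 0\<close> and then a zero column.\<close>
  then have "d 1 (y u v) = 0" for u v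
    using vsp_1_eqI[of "d 1 (y u v)" 0] d_vsp[of 1 "y u v"] b_0 by (simp add: p_def)
  then have y_filt: "y u v \<in> filt 1 3" for u v
    using filt_reflect[of 1 "y u v" 3] gens_2 y_vsp filt_zero by simp
  have "y u v = 0" for u v
  proof
    fix s
    show "y u v s = 0 s"
    proof (cases "s < b 1 \<and> deg 1 s = 2")
      case True
      then have "ordge 1 (y u v s)" using y_filt[of u v] by (auto simp: filt_def)
      then show ?thesis using True by (simp add: ordge_1_iff y_def)
    next
      case False
      then show ?thesis using y_zero y_vsp[of u v] by (auto simp: vsp_def not_less)
    qed
  qed
  then have z_filt: "z v \<in> filt 2 4" for v
    using filt_reflect[of 2 "z v" 4] gens_3_weak z_vsp filt_zero dz by simp
  have "z v = 0" for v
  proof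
    fix r
    show "z v r = 0 r"
    proof (cases "r < b 2 \<and> deg 2 r = 3")
      case True
      then have "ordge 1 (z v r)" using z_filt[of v] by (auto simp: filt_def)
      then show ?thesis using True by (simp add: ordge_1_iff z_def)
    next
      case False
      then show ?thesis using z_zero z_vsp[of v] by (auto simp: vsp_def not_less)
    qed
  qed
  then have "d 3 (ev c) = 0" unfolding h by simp
  moreover obtain r where "r < b 2" "D 3 r c \<noteq> 0" using column_nonzero[of 3 c] c by auto
  ultimately show False using dmap_ev[of 3 c b r D] c by simp
qed

end

section \<open>Non-existence for at least six vertices\<close>

context cycle_resolution begin

lemma ev_filt: "c < b i \<Longrightarrow> t \<le> deg i c \<Longrightarrow> ev c \<in> filt i t"
  by (simp add: filt_def ev_vsp) (simp add: ev_def)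

lemma filt_entry: "a \<in> filt i t \<Longrightarrow> j < b i \<Longrightarrow> k + deg i j \<le> t \<Longrightarrow> ordge k (a j)"
  by (auto simp: filt_def intro: ordge_mono)

lemma X_eq_Var: "i < n \<Longrightarrow> X i = Var (f i)"
  by (simp add: X_def)

text \<open>The products are abstracted to two families of maps linear in the second factor. Graded
  commutativity is built into \<open>assoc\<close>, where the product of \<open>e e'\<close> with
  \<open>e''\<close> is written with \<open>e''\<close> in front.\<close>

lemma no_associative_products:
  fixes \<mu> \<nu> :: "(nat \<Rightarrow> ('v, 'k) mpoly) \<Rightarrow> (nat \<Rightarrow> ('v, 'k) mpoly) \<Rightarrow> (nat \<Rightarrow> ('v, 'k) mpoly)"
  assumes n6: "6 \<le> n"
    and \<mu>: "\<And>e. e \<in> vsp (b 1) \<Longrightarrow> lin (b 1) (b 2) (\<mu> e)"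
    and \<nu>: "\<And>e. e \<in> vsp (b 1) \<Longrightarrow> lin (b 2) (b 3) (\<nu> e)"
    and leibniz_\<mu>: "\<And>e e'. e \<in> vsp (b 1) \<Longrightarrow> e' \<in> vsp (b 1) \<Longrightarrow>
      d 2 (\<mu> e e') = smul (d 1 e 0) e' - smul (d 1 e' 0) e"
    and leibniz_\<nu>: "\<And>e g. e \<in> vsp (b 1) \<Longrightarrow> g \<in> vsp (b 2) \<Longrightarrow>
      d 3 (\<nu> e g) = smul (d 1 e 0) g - \<mu> e (d 2 g)"
    and assoc: "\<And>e e' e''. e \<in> vsp (b 1) \<Longrightarrow> e' \<in> vsp (b 1) \<Longrightarrow> e'' \<in> vsp (b 1) \<Longrightarrow>
      \<nu> e'' (\<mu> e e') = \<nu> e (\<mu> e' e'')"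
  shows False
proof -
  have gens_3: "gens 3 5" using gens_3 n6 by simp
  have gens_4: "gens 4 6" using gens_Suc[OF gens_3] by simp
  have \<mu>_vsp: "\<mu> e e' \<in> vsp (b 2)" if "e \<in> vsp (b 1)" "e' \<in> vsp (b 1)" for e e'
    using \<mu> that by (blast intro: lin_vsp)
  have \<nu>_vsp: "\<nu> e g \<in> vsp (b 3)" if "e \<in> vsp (b 1)" "g \<in> vsp (b 2)" for e g
    using \<nu> that by (blast intro: lin_vsp)
  \<comment> \<open>The Leibniz rule bounds the differential of the product;
    \<open>filt_reflect\<close> transfers the bound as long as \<open>F_3\<close> is generated in
    degrees at least \<open>t + 2\<close>, whence \<open>t \<le> 3\<close>.\<close>
  have \<mu>_filt: "\<mu> e e' \<in> filt 2 (t + 2)" if e: "e \<in> vsp (b 1)" and e': "e' \<in> filt 1 t" and t: "t \<le> 3" for e e' t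
  proof -
    have e'1: "e' \<in> vsp (b 1)" using e' by (rule filt_vsp)
    have "d 1 e' \<in> filt 0 t" using filt_d[of 1 e' t] e' by simp
    then have "ordge t (d 1 e' 0)" by (rule filt_entry) (simp_all add: b_0 deg_0)
    then have "smul (d 1 e' 0) e \<in> filt 1 (t + 2)"
      using filt_gens[OF gens_1 e] by (rule filt_smul) simp
    moreover have "smul (d 1 e 0) e' \<in> filt 1 (t + 2)"
      using d1_ordge[OF e] e' by (rule filt_smul) simp
    ultimately have "d 2 (\<mu> e e') \<in> filt 1 (t + 2)"
      using leibniz_\<mu>[OF e e'1] filt_diff by simp
    then show ?thesis
      using filt_reflect[of 2 "\<mu> e e'" "t + 2"] gens_mono[OF gens_3, of "t + 2"] t \<mu>_vsp[OF e e'1] by simp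
  qed
  \<comment> \<open>In \<open>d 2 g\<close> a basis element of degree 2 has a coefficient of order
    2, and one of higher degree a coefficient of order 1 but a product in degree 5. Either way
    degree 6 is reached, and \<open>gens_4\<close> transfers the bound.\<close>
  have \<nu>_filt: "\<nu> e g \<in> filt 3 6" if e: "e \<in> vsp (b 1)" and g: "g \<in> filt 2 4" for e g
  proof -
    have g2: "g \<in> vsp (b 2)" using g by (rule filt_vsp)
    have dg: "d 2 g \<in> filt 1 4" using filt_d[of 2 g 4] g by simp
    have "smul (d 2 g c) (\<mu> e (ev c)) \<in> filt 2 6" if c: "c < b 1" for c
    proof (cases "deg 1 c = 2")
      case True
      have "ordge 2 (d 2 g c)" using dg c by (rule filt_entry) (simp add: True)
      moreover have "\<mu> e (ev c) \<in> filt 2 (2 + 2)"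
        using e ev_filt[OF c] True by (intro \<mu>_filt) auto
      ultimately show ?thesis by (rule filt_smul) simp
    next
      case False
      then have "3 \<le> deg 1 c" using gens_1 c by (force simp: gens_def)
      then have "\<mu> e (ev c) \<in> filt 2 (3 + 2)"
        using e ev_filt[OF c] by (intro \<mu>_filt) auto
      moreover have "ordge 1 (d 2 g c)" using d_ordge_1[of 2 c g] c by simp
      ultimately show ?thesis by (intro filt_smul) auto
    qed
    then have "\<mu> e (d 2 g) \<in> filt 2 6"
      using lin_expand[OF \<mu>[OF e], of "d 2 g"] filt_vsp[OF dg] by (auto intro: filt_sum)
    moreover have "smul (d 1 e 0) g \<in> filt 2 6"
      using d1_ordge[OF e] g by (rule filt_smul) simp
    ultimately have "d 3 (\<nu> e g) \<in> filt 2 6"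
      using leibniz_\<nu>[OF e g2] filt_diff by simp
    then show ?thesis
      using filt_reflect[of 3 "\<nu> e g" 6] gens_4 \<nu>_vsp[OF e g2] by simp
  qed
  \<comment> \<open>Boundaries multiply into degree 7, so the unknown corrections \<open>w\<close>
    chosen below are invisible in degree 6.\<close>
  have \<nu>_boundary: "\<nu> e (d 3 w) \<in> filt 3 7" if e: "e \<in> vsp (b 1)" and w: "w \<in> vsp (b 3)" for e w
  proof -
    have dw: "d 3 w \<in> filt 2 5" using filt_d[of 3 w 5] filt_gens[OF gens_3 w] by simp
    have "smul (d 3 w c) (\<nu> e (ev c)) \<in> filt 3 7" if c: "c < b 2" for c
    proof (cases "deg 2 c = 3")
      case True
      have "ordge 2 (d 3 w c)" using dw c by (rule filt_entry) (simp add: True)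
      moreover have "\<nu> e (ev c) \<in> filt 3 5"
        using filt_gens[OF gens_3] \<nu>_vsp[OF e ev_vsp[OF c]] by simp
      ultimately show ?thesis by (rule filt_smul) simp
    next
      case False
      then have "4 \<le> deg 2 c" using gens_2 c by (force simp: gens_def)
      then have "\<nu> e (ev c) \<in> filt 3 6" using e ev_filt[OF c] by (intro \<nu>_filt) auto
      moreover have "ordge 1 (d 3 w c)" using d_ordge_1[of 3 c w] c by simp
      ultimately show ?thesis by (intro filt_smul) auto
    qed
    then show ?thesis
      using lin_expand[OF \<nu>[OF e], of "d 3 w"] filt_vsp[OF dw] by (auto intro: filt_sum)
  qed
  have "\<exists>e. e \<in> vsp (b 1) \<and> d 1 e 0 = X i * X (i + 1)" for i
  proof -
    have "X i * X (i + 1) \<in> edge_ideal E"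
      unfolding X_def using edge_in_ideal[of E, OF X_edge, of 1] by simp
    then show ?thesis using d1_onto_ideal by metis
  qed
  then obtain e where e: "\<And>i. e i \<in> vsp (b 1)" and de: "\<And>i. d 1 (e i) 0 = X i * X (i + 1)"
    by metis
  have "\<exists>g. g \<in> vsp (b 2) \<and> d 2 g = smul (X i) (e (i + 1)) - smul (X (i + 2)) (e i)" for i
  proof -
    let ?c = "smul (X i) (e (i + 1)) - smul (X (i + 2)) (e i)"
    have c: "?c \<in> vsp (b 1)" by (intro vsp_intros e)
    have "i + 1 + 1 = i + 2" by simp
    then have "d 1 ?c 0 = X i * (X (i + 1) * X (i + 2)) - X (i + 2) * (X i * X (i + 1))"
      using de[of i] de[of "i + 1"] e by (simp only: d_minus d_smul vsp_smul minus_apply smul_apply)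
    then have "d 1 ?c 0 = 0" by (simp add: mult_ac)
    then have "d 1 ?c = 0"
      using vsp_1_eqI[of "d 1 ?c" 0] d_vsp[of 1 ?c] b_0 by simp
    then obtain g where "g \<in> vsp (b (1 + 1))" "?c = d (1 + 1) g"
      using boundary[of 1 ?c] c by auto
    then show ?thesis by (metis one_add_one)
  qed
  then obtain g where g: "\<And>i. g i \<in> vsp (b 2)"
    and dg: "\<And>i. d 2 (g i) = smul (X i) (e (i + 1)) - smul (X (i + 2)) (e i)"
    by metis
  \<comment> \<open>By the Leibniz rule both expressions have the same differential, so they differ
    by a boundary.\<close>
  have "\<exists>w. w \<in> vsp (b 3) \<and> \<mu> (e i) (e (i + 2)) = smul (X i) (g (i + 1)) + smul (X (i + 3)) (g i) + d 3 w" for i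
  proof -
    let ?c = "\<mu> (e i) (e (i + 2)) - (smul (X i) (g (i + 1)) + smul (X (i + 3)) (g i))"
    have c: "?c \<in> vsp (b 2)" by (intro vsp_intros \<mu>_vsp e g)
    have "d 2 ?c = smul (d 1 (e i) 0) (e (i + 2)) - smul (d 1 (e (i + 2)) 0) (e i)
        - (smul (X i) (d 2 (g (i + 1))) + smul (X (i + 3)) (d 2 (g i)))"
      by (simp only: d_minus d_plus d_smul leibniz_\<mu> e g vsp_intros \<mu>_vsp)
    also have "\<dots> = 0"
    proof -
      have ring_identity: "x0 * x1 * e2 - x2 * x3 * e0 - (x0 * (x1 * e2 - x3 * e1) + x3 * (x0 * e1 - x2 * e0)) = 0"
        for x0 x1 x2 x3 e0 e1 e2 :: "('v, 'k) mpoly"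
        by (simp add: algebra_simps)
      have shift: "i + 1 + 1 = i + 2" "i + 1 + 2 = i + 3" "i + 2 + 1 = i + 3" by simp_all
      show ?thesis
        unfolding dg de shift fun_eq_iff plus_fun_apply minus_apply smul_apply zero_fun_apply
        by (intro allI ring_identity)
    qed
    finally obtain w where w: "w \<in> vsp (b 3)" and eq: "?c = d 3 w"
      using boundary[of 2 ?c] c by auto
    have "\<mu> (e i) (e (i + 2)) = smul (X i) (g (i + 1)) + smul (X (i + 3)) (g i) + d 3 w"
      unfolding eq[symmetric] by simp
    with w show ?thesis by blast
  qed
  then obtain w where w: "\<And>i. w i \<in> vsp (b 3)"
    and prod: "\<And>i. \<mu> (e i) (e (i + 2)) = smul (X i) (g (i + 1)) + smul (X (i + 3)) (g i) + d 3 (w i)"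
    by metis
  have dw: "d 3 (w i) \<in> vsp (b 2)" for i using d_vsp[of 3 "w i"] by simp
  have prod_\<nu>: "\<nu> (e j) (\<mu> (e i) (e (i + 2))) =
      smul (X i) (\<nu> (e j) (g (i + 1))) + smul (X (i + 3)) (\<nu> (e j) (g i)) + \<nu> (e j) (d 3 (w i))" for i j
    unfolding prod using e g dw
    by (simp only: lin_plus[OF \<nu>] lin_smul[OF \<nu>] vsp_intros)
  have X: "(X i :: ('v, 'k) mpoly) = Var (f i)" if "i < 6" for i using that n6 by (simp add: X_eq_Var)
  have f_ne: "f i \<noteq> f j" if "i < 6" "j < 6" "i \<noteq> j" for i j using that n6 by (simp add: f_eq_iff)
  have lookup_X: "lookup (X i * p) m = 0" if "i < 6" "lookup m (f i) = 0"
    for i m and p :: "('v, 'k) mpoly"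
    unfolding X[OF that(1)] using that(2) by (rule lookup_Var_mult_eq_0)
  have lookup_X': "lookup (X i * p) (xm (f i) + m) = lookup p m" if "i < 6"
    for i m and p :: "('v, 'k) mpoly"
    unfolding X[OF that] by (rule lookup_Var_mult)
  text \<open>Comparing the two triple products in degree 6 forces \<open>e\<^sub>0 g\<^sub>3\<close> into the maximal ideal.\<close>
  have "\<nu> (e 4) (\<mu> (e 0) (e 2)) = \<nu> (e 0) (\<mu> (e 2) (e 4))"
    by (rule assoc) (rule e)+
  then have eq: "smul (X 0) (\<nu> (e 4) (g 1)) + smul (X 3) (\<nu> (e 4) (g 0)) + \<nu> (e 4) (d 3 (w 0))
      = smul (X 2) (\<nu> (e 0) (g 3)) + smul (X 5) (\<nu> (e 0) (g 2)) + \<nu> (e 0) (d 3 (w 2))"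
    using prod_\<nu>[of 4 0] prod_\<nu>[of 0 2] by simp
  have "ordge (6 - deg 3 r) (\<nu> (e 0) (g 3) r)" if r: "r < b 3" for r
  proof (cases "deg 3 r = 5")
    case False
    then have "6 \<le> deg 3 r" using gens_3 r by (force simp: gens_def)
    then show ?thesis by simp
  next
    case True
    have small: "lookup (\<nu> (e i) (d 3 (w j)) r) (xm (f 2)) = 0" for i j
      using filt_entry[OF \<nu>_boundary[OF e w] r, of 2 i j] True by (simp add: ordge_iff)
    \<comment> \<open>Compare coefficients of the variable \<open>f 2\<close>. It does not divide
      into the multiples of \<open>X 0\<close>, \<open>X 3\<close>, \<open>X 5\<close>, and the
      boundary terms have order 2, so only the constant term of the product of \<open>e 0\<close>
      and \<open>g 3\<close> remains.\<close>
    have "lookup (X 0 * \<nu> (e 4) (g 1) r + X 3 * \<nu> (e 4) (g 0) r + \<nu> (e 4) (d 3 (w 0)) r) (xm (f 2) + 0)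
        = lookup (X 2 * \<nu> (e 0) (g 3) r + X 5 * \<nu> (e 0) (g 2) r + \<nu> (e 0) (d 3 (w 2)) r) (xm (f 2) + 0)"
      using fun_cong[OF eq, of r] by simp
    then have "lookup (\<nu> (e 0) (g 3) r) 0 = 0"
      unfolding lookup_add[of "_ + _"] lookup_add[of "_ * _"]
      using small by (simp add: lookup_X lookup_X'[of 2 _ 0, simplified] lookup_xm f_ne)
    then show ?thesis using True by (simp add: ordge_1_iff)
  qed
  then have "\<nu> (e 0) (g 3) \<in> filt 3 6" using \<nu>_vsp[OF e g] by (simp add: filt_def)
  then have "d 3 (\<nu> (e 0) (g 3)) \<in> filt 2 6" using filt_d[of 3 _ 6] by simp
  moreover have "d 3 (\<nu> (e 0) (g 3)) = smul (X 0 * X 1) (g 3)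
      - (smul (X 3) (\<mu> (e 0) (e 4)) - smul (X 5) (\<mu> (e 0) (e 3)))"
    unfolding leibniz_\<nu>[OF e g] dg de using e
    by (simp add: lin_minus2[OF \<mu>[OF e]] lin_smul[OF \<mu>[OF e]] vsp_smul)
  ultimately have d\<nu>: "smul (X 0 * X 1) (g 3)
      - (smul (X 3) (\<mu> (e 0) (e 4)) - smul (X 5) (\<mu> (e 0) (e 3))) \<in> filt 2 6" by simp
  \<comment> \<open>In a coordinate of degree 3 the difference has order 3, and the terms with
    \<open>X 3\<close> and \<open>X 5\<close> do not contain the monomial of
    \<open>X 0 * X 1\<close>. Hence \<open>g 3\<close> has no constant term there.\<close>
  have "ordge (4 - deg 2 r) (g 3 r)" if r: "r < b 2" for r
  proof (cases "deg 2 r = 3")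
    case False
    then have "4 \<le> deg 2 r" using gens_2 r by (force simp: gens_def)
    then show ?thesis by simp
  next
    case True
    let ?m = "xm (f 0) + (xm (f 1) + 0)"
    have "ordge 3 (X 0 * (X 1 * g 3 r) - (X 3 * \<mu> (e 0) (e 4) r - X 5 * \<mu> (e 0) (e 3) r))"
      using filt_entry[OF d\<nu> r, of 3] True by (simp add: mult.assoc)
    then have "lookup (X 0 * (X 1 * g 3 r)) ?m - (lookup (X 3 * \<mu> (e 0) (e 4) r) ?m - lookup (X 5 * \<mu> (e 0) (e 3) r) ?m) = 0"
      unfolding lookup_minus[symmetric] by (simp only: ordge_iff) (simp add: tdeg_add)
    then have "lookup (X 0 * (X 1 * g 3 r)) ?m = 0"
      by (simp add: lookup_X lookup_add lookup_xm f_ne)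
    then have "lookup (g 3 r) 0 = 0"
      by (simp only: lookup_X')
    then show ?thesis using True by (simp add: ordge_1_iff)
  qed
  then have "g 3 \<in> filt 2 4" using g by (simp add: filt_def)
  then have "d 2 (g 3) \<in> filt 1 4" using filt_d[of 2 _ 4] by simp
  then have dg3: "smul (X 3) (e 4) - smul (X 5) (e 3) \<in> filt 1 4" unfolding dg by simp
  \<comment> \<open>The same comparison one step lower, at the monomial of
    \<open>X 3\<close>.\<close>
  have "ordge (3 - deg 1 s) (e 4 s)" if s: "s < b 1" for s
  proof (cases "deg 1 s = 2")
    case False
    then have "3 \<le> deg 1 s" using gens_1 s by (force simp: gens_def)
    then show ?thesis by simp
  next
    case True
    let ?m = "xm (f 3) + 0"
    have "ordge 2 (X 3 * e 4 s - X 5 * e 3 s)"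
      using filt_entry[OF dg3 s, of 2] True by simp
    then have "lookup (X 3 * e 4 s) ?m - lookup (X 5 * e 3 s) ?m = 0"
      unfolding lookup_minus[symmetric] by (simp only: ordge_iff) simp
    then have "lookup (X 3 * e 4 s) ?m = 0"
      by (simp add: lookup_X lookup_xm f_ne)
    then have "lookup (e 4 s) 0 = 0"
      by (simp only: lookup_X')
    then show ?thesis using True by (simp add: ordge_1_iff)
  qed
  then have "e 4 \<in> filt 1 3" using e by (simp add: filt_def)
  then have "d 1 (e 4) \<in> filt 0 3" using filt_d[of 1 _ 3] by simp
  then have "ordge 3 (d 1 (e 4) 0)" by (rule filt_entry) (simp_all add: b_0 deg_0)
  \<comment> \<open>The boundary of \<open>e 4\<close> is a monomial of degree 2, which cannot have
    order 3.\<close>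
  then have "ordge 3 (X 4 * (X 5 * (1 :: ('v, 'k) mpoly)))" using de[of 4] by simp
  then have "lookup (X 4 * (X 5 * (1 :: ('v, 'k) mpoly))) (xm (f 4) + (xm (f 5) + 0)) = 0"
    by (simp only: ordge_iff) (simp add: tdeg_add)
  then show False by (simp only: lookup_X') simp
qed

text \<open>Restricting the structure to factors of degrees 1 and 2 and normalising the unit reduces
  the claim to \<open>no_associative_products\<close>.\<close>

lemma no_dga_structure:
  assumes n6: "6 \<le> n" shows "\<not> is_dga_structure b D mult"
proof
  assume dga: "is_dga_structure b D mult"
  note dga' = dga[unfolded is_dga_structure_def fmod_eq vadd_eq]
  have closed: "\<forall>i j a c. a \<in> vsp (b i) \<longrightarrow> c \<in> vsp (b j) \<longrightarrow> mult i j a c \<in> vsp (b (i + j))"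
    using dga' by (elim conjE)
  have add1: "\<forall>i j a a' c. a \<in> vsp (b i) \<longrightarrow> a' \<in> vsp (b i) \<longrightarrow> c \<in> vsp (b j) \<longrightarrow>
      mult i j (a + a') c = mult i j a c + mult i j a' c"
    using dga' by (elim conjE)
  have add2: "\<forall>i j a c c'. a \<in> vsp (b i) \<longrightarrow> c \<in> vsp (b j) \<longrightarrow> c' \<in> vsp (b j) \<longrightarrow>
      mult i j a (c + c') = mult i j a c + mult i j a c'"
    using dga' by (elim conjE)
  have scale: "\<forall>i j s a c. a \<in> vsp (b i) \<longrightarrow> c \<in> vsp (b j) \<longrightarrow>
      mult i j (smul s a) c = smul s (mult i j a c) \<and> mult i j a (smul s c) = smul s (mult i j a c)"
    using dga' by (elim conjE)
  have unit: "\<exists>e\<in>vsp (b 0). \<forall>j a. a \<in> vsp (b j) \<longrightarrow> mult 0 j e a = a \<and> mult j 0 a e = a"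
    using dga' by (elim conjE)
  have assoc: "\<forall>i j k a c f. a \<in> vsp (b i) \<longrightarrow> c \<in> vsp (b j) \<longrightarrow> f \<in> vsp (b k) \<longrightarrow>
      mult (i + j) k (mult i j a c) f = mult i (j + k) a (mult j k c f)"
    using dga' by (elim conjE)
  have comm: "\<forall>i j a c. a \<in> vsp (b i) \<longrightarrow> c \<in> vsp (b j) \<longrightarrow>
      mult i j a c = smul ((-1) ^ (i * j)) (mult j i c a)"
    using dga' by (elim conjE)
  have leibniz: "\<forall>i j a c. a \<in> vsp (b i) \<longrightarrow> c \<in> vsp (b j) \<longrightarrow> d (i + j) (mult i j a c) =
      mult (i - 1) j (d i a) c + smul ((-1) ^ i) (mult i (j - 1) a (d j c))"
    using dga' by (elim conjE)
  obtain \<epsilon> where \<epsilon>: "\<epsilon> \<in> vsp (b 0)" "\<And>j a. a \<in> vsp (b j) \<Longrightarrow> mult 0 j \<epsilon> a = a \<and> mult j 0 a \<epsilon> = a"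
    using unit by blast
  define u where "u = \<epsilon> 0"
  have \<epsilon>_eq: "\<epsilon> = smul u (ev 0)" using vsp_1_eq[of \<epsilon>] \<epsilon>(1) b_0 by (simp add: u_def)
  have ev0: "ev 0 \<in> vsp (b 0)" using b_0 by (simp add: ev_vsp)
  text \<open>The unit need not be the basis vector of \<open>F\<^sub>0\<close>, only a multiple \<open>u\<close> of it;
    rescaling the product by \<open>u\<close> repairs this.\<close>
  have F0: "a = smul (a 0) (ev 0)" if "a \<in> vsp (b 0)" for a :: "nat \<Rightarrow> ('v, 'k) mpoly"
    using vsp_1_eq that b_0 by simp
  have left: "smul u (mult 0 j a c) = smul (a 0) c" if "a \<in> vsp (b 0)" "c \<in> vsp (b j)" for j a c
  proof -
    have "smul u (mult 0 j a c) = smul (a 0) (smul u (mult 0 j (ev 0) c))"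
      using scale ev0 that(2) F0[OF that(1)] by (metis smul_smul mult.commute)
    also have "smul u (mult 0 j (ev 0) c) = c"
      using \<epsilon>(2)[OF that(2)] scale ev0 that(2) \<epsilon>_eq by metis
    finally show ?thesis .
  qed
  have right: "smul u (mult j 0 c a) = smul (a 0) c" if "a \<in> vsp (b 0)" "c \<in> vsp (b j)" for j a c
  proof -
    have "smul u (mult j 0 c a) = smul (a 0) (smul u (mult j 0 c (ev 0)))"
      using scale ev0 that(2) F0[OF that(1)] by (metis smul_smul mult.commute)
    also have "smul u (mult j 0 c (ev 0)) = c"
      using \<epsilon>(2)[OF that(2)] scale ev0 that(2) \<epsilon>_eq by metis
    finally show ?thesis .
  qed
  have closed11: "mult 1 1 a c \<in> vsp (b 2)" if "a \<in> vsp (b 1)" "c \<in> vsp (b 1)" for a c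
    using closed that by (metis one_add_one)
  have closed12: "mult 1 2 a c \<in> vsp (b 3)" if "a \<in> vsp (b 1)" "c \<in> vsp (b 2)" for a c
    using closed[rule_format, of a 1 c 2] that by simp
  define \<mu> where "\<mu> = (\<lambda>a c. smul u (mult 1 1 a c))"
  define \<nu> where "\<nu> = (\<lambda>a c. smul u (mult 1 2 a c))"
  show False
  proof (rule no_associative_products[OF n6, of \<mu> \<nu>])
    fix e :: "nat \<Rightarrow> ('v, 'k) mpoly"
    assume e: "e \<in> vsp (b 1)"
    show "lin (b 1) (b 2) (\<mu> e)"
      unfolding lin_def \<mu>_def using closed11 e add2 scale
      by (auto simp: vsp_smul smul_add smul_smul mult.commute)
    show "lin (b 2) (b 3) (\<nu> e)"
      unfolding lin_def \<nu>_def using closed12 e add2 scale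
      by (auto simp: vsp_smul smul_add smul_smul mult.commute)
  next
    fix e e' :: "nat \<Rightarrow> ('v, 'k) mpoly"
    assume e: "e \<in> vsp (b 1)" "e' \<in> vsp (b 1)"
    have d0: "d 1 a \<in> vsp (b 0)" for a using d_vsp[of 1 a] by simp
    have "d 2 (mult 1 1 e e') = mult 0 1 (d 1 e) e' - mult 1 0 e (d 1 e')"
      using leibniz[rule_format, of e 1 e' 1] e by (simp add: smul_minus_left)
    then show "d 2 (\<mu> e e') = smul (d 1 e 0) e' - smul (d 1 e' 0) e"
      unfolding \<mu>_def using closed11 e by (simp add: d_smul smul_diff left right d0)
  next
    fix e g :: "nat \<Rightarrow> ('v, 'k) mpoly"
    assume e: "e \<in> vsp (b 1)" "g \<in> vsp (b 2)"
    have d0: "d 1 a \<in> vsp (b 0)" for a using d_vsp[of 1 a] by simp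
    have "d 3 (mult 1 2 e g) = mult 0 2 (d 1 e) g - mult 1 1 e (d 2 g)"
      using leibniz[rule_format, of e 1 g 2] e by (simp add: smul_minus_left)
    then show "d 3 (\<nu> e g) = smul (d 1 e 0) g - \<mu> e (d 2 g)"
      unfolding \<nu>_def \<mu>_def using closed12 e by (simp add: d_smul smul_diff left d0)
  next
    fix e e' e'' :: "nat \<Rightarrow> ('v, 'k) mpoly"
    assume e: "e \<in> vsp (b 1)" "e' \<in> vsp (b 1)" "e'' \<in> vsp (b 1)"
    \<comment> \<open>The sign for degrees 1 and 2 is positive, so \<open>e''\<close> may be moved
      past the product.\<close>
    have "mult 1 2 e'' (mult 1 1 e e') = mult 2 1 (mult 1 1 e e') e''"
      using comm[rule_format, of e'' 1 "mult 1 1 e e'" 2] closed11 e by simp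
    also have "\<dots> = mult 1 2 e (mult 1 1 e' e'')"
      using assoc[rule_format, of e 1 e' 1 e'' 1] e by simp
    finally show "\<nu> e'' (\<mu> e e') = \<nu> e (\<mu> e' e'')"
      unfolding \<nu>_def \<mu>_def using scale closed11 e by simp
  qed
qed

end

section \<open>Products on resolutions of length 3\<close>

lemma lin_ext:
  assumes "lin N M f" "lin N M g" "\<And>c. c < N \<Longrightarrow> f (ev c) = g (ev c)" "v \<in> vsp N"
  shows "f v = g v"
  unfolding lin_expand[OF assms(1,4)] lin_expand[OF assms(2,4)] using assms(3) by simp

definition bilin :: "nat \<Rightarrow> nat \<Rightarrow> (nat \<Rightarrow> nat \<Rightarrow> nat \<Rightarrow> ('v, 'k::field) mpoly) \<Rightarrow>
    (nat \<Rightarrow> ('v, 'k) mpoly) \<Rightarrow> (nat \<Rightarrow> ('v, 'k) mpoly) \<Rightarrow> (nat \<Rightarrow> ('v, 'k) mpoly)" where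
  "bilin N K Y a c = (\<Sum>j<N. \<Sum>k<K. smul (a j * c k) (Y j k))"

lemma bilin_lin_left:
  assumes "\<And>j k. j < N \<Longrightarrow> k < K \<Longrightarrow> Y j k \<in> vsp M"
  shows "lin N M (\<lambda>a. bilin N K Y a c)"
  unfolding lin_def bilin_def using assms
  by (auto intro!: vsp_intros simp: distrib_right smul_add_left sum.distrib smul_sum smul_smul mult.assoc)

lemma bilin_lin_right:
  assumes "\<And>j k. j < N \<Longrightarrow> k < K \<Longrightarrow> Y j k \<in> vsp M"
  shows "lin K M (bilin N K Y a)"
  unfolding lin_def bilin_def using assms
  by (auto intro!: vsp_intros simp: distrib_left smul_add_left sum.distrib smul_sum smul_smul mult.left_commute)

lemma bilin_ev:
  assumes "i < N" "l < K" shows "bilin N K Y (ev i) (ev l) = Y i l"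
proof -
  have "bilin N K Y (ev i) (ev l) = (\<Sum>j<N. smul (ev i j) (\<Sum>k<K. smul (ev l k) (Y j k)))"
    by (simp add: bilin_def smul_sum smul_smul)
  then show ?thesis using assms by (simp add: combination_ev)
qed

text \<open>Off-diagonal entries cancel in pairs. The diagonal is assumed to vanish separately,
  since antisymmetry alone only says that twice a diagonal entry is zero.\<close>

lemma alternating_sum:
  fixes t :: "nat \<Rightarrow> nat \<Rightarrow> 'a::ab_group_add"
  assumes "\<And>j. t j j = 0" "\<And>j k. t k j = - t j k"
  shows "(\<Sum>j<N. \<Sum>k<N. t j k) = 0"
proof (induction N)
  case (Suc N)
  have "(\<Sum>j<N. t N j) = - (\<Sum>j<N. t j N)"
    unfolding sum_negf[symmetric] by (intro sum.cong refl assms(2))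
  then show ?case using Suc assms(1) by (simp add: sum.distrib)
qed simp

context minimal_resolution begin

lemma smul_b_0_commute: "a \<in> vsp (b 0) \<Longrightarrow> c \<in> vsp (b 0) \<Longrightarrow> smul (a 0) c = smul (c 0) a"
  by (rule vsp_1_eqI) (simp_all add: b_0 vsp_smul mult.commute)

text \<open>Lifts chosen on basis pairs \<open>j < k\<close> only, and extended with sign, make
  squares vanish in every characteristic. The Leibniz rule is then checked on basis pairs and
  extended by linearity in each argument.\<close>

lemma exists_degree_1_product:
  obtains \<mu> where "\<And>a. lin (b 1) (b 2) (\<mu> a)" "\<And>c. lin (b 1) (b 2) (\<lambda>a. \<mu> a c)"
    "\<And>a. \<mu> a a = 0" "\<And>a c. \<mu> c a = - \<mu> a c"
    "\<And>a c. a \<in> vsp (b 1) \<Longrightarrow> c \<in> vsp (b 1) \<Longrightarrow>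
      d 2 (\<mu> a c) = smul (d 1 a 0) c - smul (d 1 c 0) a"
proof -
  define s where "s = (\<lambda>j. d 1 (ev j) 0)"
  have "\<exists>y. j < b 1 \<longrightarrow> k < b 1 \<longrightarrow> y \<in> vsp (b 2) \<and> d 2 y = smul (s j) (ev k) - smul (s k) (ev j)" for j k
  proof (cases "j < b 1 \<and> k < b 1")
    case True
    let ?c = "smul (s j) (ev k) - smul (s k) (ev j)"
    have c: "?c \<in> vsp (b 1)" using True by (intro vsp_intros) auto
    have "d 1 ?c 0 = 0" using True by (simp add: d_minus d_smul vsp_intros s_def)
    then have "d 1 ?c = 0" using vsp_1_eqI[of "d 1 ?c" 0] d_vsp[of 1 ?c] b_0 by simp
    then show ?thesis using boundary[of 1 ?c] c by (metis le_refl one_add_one)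
  qed auto
  then obtain Y0 where Y0: "\<And>j k. j < b 1 \<Longrightarrow> k < b 1 \<Longrightarrow>
      Y0 j k \<in> vsp (b 2) \<and> d 2 (Y0 j k) = smul (s j) (ev k) - smul (s k) (ev j)" by metis
  define Y where "Y = (\<lambda>j k. if j < k then Y0 j k else if k < j then - Y0 k j else 0)"
  have Y_vsp: "Y j k \<in> vsp (b 2)" if "j < b 1" "k < b 1" for j k
    using Y0 that by (simp add: Y_def vsp_minus)
  have dY: "d 2 (Y j k) = smul (s j) (ev k) - smul (s k) (ev j)" if "j < b 1" "k < b 1" for j k
    using Y0 that lin_minus[OF d_lin[of 2], of "Y0 k j"] lin_zero[OF d_lin[of 2]]
    by (auto simp: Y_def)
  have Y_alt: "Y j j = 0" "Y k j = - Y j k" for j k by (auto simp: Y_def)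
  define \<mu> where "\<mu> = bilin (b 1) (b 1) Y"
  have right: "lin (b 1) (b 2) (\<mu> a)" and left: "lin (b 1) (b 2) (\<lambda>a. \<mu> a c)" for a c
    unfolding \<mu>_def using bilin_lin_right[OF Y_vsp] bilin_lin_left[OF Y_vsp] by auto
  have square: "\<mu> a a = 0" for a
    unfolding \<mu>_def bilin_def
  proof (rule alternating_sum)
    show "smul (a j * a j) (Y j j) = 0" for j by (simp add: Y_alt(1))
    show "smul (a k * a j) (Y k j) = - smul (a j * a k) (Y j k)" for j k
      by (subst Y_alt(2)) (simp add: smul_minus mult.commute)
  qed
  have anti: "\<mu> c a = - \<mu> a c" for a c
  proof -
    have "(\<Sum>k<b 1. \<Sum>j<b 1. smul (c j * a k) (Y j k)) = (\<Sum>k<b 1. \<Sum>j<b 1. - smul (a k * c j) (Y k j))"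
      by (intro sum.cong refl, subst Y_alt(2)) (simp add: smul_minus mult.commute)
    then show ?thesis
      unfolding \<mu>_def bilin_def sum_negf by (subst sum.swap)
  qed
  have leibniz: "d 2 (\<mu> a c) = smul (d 1 a 0) c - smul (d 1 c 0) a"
    if a: "a \<in> vsp (b 1)" and c: "c \<in> vsp (b 1)" for a c
  proof -
    have d2: "lin (b 2) (b 1) (d 2)" and d1: "lin (b 1) (b 0) (d 1)"
      using d_lin[of 2] d_lin[of 1] by simp_all
    have L: "lin (b 1) (b 1) (\<lambda>c. smul (d 1 a 0) c - smul (d 1 c 0) a)"
      if "a \<in> vsp (b 1)" for a
      unfolding lin_def using that
      by (auto simp: vsp_intros lin_plus[OF d1] lin_smul[OF d1] smul_add smul_add_left smul_diff
          smul_smul mult.commute)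
    have R: "lin (b 1) (b 1) (\<lambda>a. smul (d 1 a 0) c - smul (d 1 c 0) a)"
      if "c \<in> vsp (b 1)" for c
      unfolding lin_def using that
      by (auto simp: vsp_intros lin_plus[OF d1] lin_smul[OF d1] smul_add smul_add_left smul_diff
          smul_smul mult.commute)
    have "d 2 (\<mu> (ev j) c) = smul (d 1 (ev j) 0) c - smul (d 1 c 0) (ev j)" if j: "j < b 1" for j
      using lin_compose[OF right d2] L[OF ev_vsp[OF j]] _ c
    proof (rule lin_ext)
      fix k assume k: "k < b 1"
      show "d 2 (\<mu> (ev j) (ev k)) = smul (d 1 (ev j) 0) (ev k) - smul (d 1 (ev k) 0) (ev j)"
        unfolding \<mu>_def using dY[OF j k] by (simp add: bilin_ev[OF j k] s_def)
    qed
    then show ?thesis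
      using lin_ext[OF lin_compose[OF left d2] R[OF c] _ a] by blast
  qed
  show thesis using that[OF right left square anti leibniz] .
qed

text \<open>On basis pairs the prescribed right-hand side is a cycle: the Leibniz rule for
  \<open>\<mu>\<close> turns \<open>d 2 (\<mu> a (d 2 c))\<close> into
  \<open>smul (d 1 a 0) (d 2 c)\<close>, as \<open>d 1 (d 2 c)\<close> vanishes. Exactness supplies
  the values.\<close>

lemma exists_degree_2_product:
  assumes \<mu>: "\<And>a. lin (b 1) (b 2) (\<mu> a)" "\<And>c. lin (b 1) (b 2) (\<lambda>a. \<mu> a c)"
    and leibniz_\<mu>: "\<And>a c. a \<in> vsp (b 1) \<Longrightarrow> c \<in> vsp (b 1) \<Longrightarrow>
      d 2 (\<mu> a c) = smul (d 1 a 0) c - smul (d 1 c 0) a"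
  obtains \<nu> where "\<And>a. lin (b 2) (b 3) (\<nu> a)" "\<And>c. lin (b 1) (b 3) (\<lambda>a. \<nu> a c)"
    "\<And>a c. a \<in> vsp (b 1) \<Longrightarrow> c \<in> vsp (b 2) \<Longrightarrow>
      d 3 (\<nu> a c) = smul (d 1 a 0) c - \<mu> a (d 2 c)"
proof -
  have d3: "lin (b 3) (b 2) (d 3)" and d2: "lin (b 2) (b 1) (d 2)" and d1: "lin (b 1) (b 0) (d 1)"
    using d_lin[of 3] d_lin[of 2] d_lin[of 1] by simp_all
  have "\<exists>y. j < b 1 \<longrightarrow> k < b 2 \<longrightarrow> y \<in> vsp (b 3) \<and>
      d 3 y = smul (d 1 (ev j) 0) (ev k) - \<mu> (ev j) (d 2 (ev k))" for j k
  proof (cases "j < b 1 \<and> k < b 2")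
    case True
    then have ev: "(ev j :: nat \<Rightarrow> ('v, 'k) mpoly) \<in> vsp (b 1)" "(ev k :: nat \<Rightarrow> ('v, 'k) mpoly) \<in> vsp (b 2)"
      by (auto intro: ev_vsp)
    have dk: "d 2 (ev k) \<in> vsp (b 1)" using lin_vsp[OF d2] ev by blast
    let ?c = "smul (d 1 (ev j) 0) (ev k) - \<mu> (ev j) (d 2 (ev k))"
    have c: "?c \<in> vsp (b 2)" using ev dk lin_vsp[OF \<mu>(1)] by (intro vsp_diff vsp_smul)
    have "d 1 (d 2 (ev k)) = 0" using d_d[of 1 "ev k"] ev by simp
    then have "d 2 ?c = 0"
      using ev dk lin_vsp[OF \<mu>(1)] leibniz_\<mu>
      by (simp add: lin_minus2[OF d2] lin_smul[OF d2] vsp_intros)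
    then obtain y where "y \<in> vsp (b (2 + 1))" "?c = d (2 + 1) y"
      using boundary[of 2 ?c] c by auto
    then show ?thesis by (intro exI[of _ y]) simp
  qed auto
  then obtain Y where Y: "\<And>j k. j < b 1 \<Longrightarrow> k < b 2 \<Longrightarrow> Y j k \<in> vsp (b 3) \<and>
      d 3 (Y j k) = smul (d 1 (ev j) 0) (ev k) - \<mu> (ev j) (d 2 (ev k))" by metis
  define \<nu> where "\<nu> = bilin (b 1) (b 2) Y"
  have right: "lin (b 2) (b 3) (\<nu> a)" and left: "lin (b 1) (b 3) (\<lambda>a. \<nu> a c)" for a c
    unfolding \<nu>_def by (rule bilin_lin_right bilin_lin_left; simp add: Y)+
  have leibniz: "d 3 (\<nu> a c) = smul (d 1 a 0) c - \<mu> a (d 2 c)"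
    if a: "a \<in> vsp (b 1)" and c: "c \<in> vsp (b 2)" for a c
  proof -
    have L: "lin (b 2) (b 2) (\<lambda>c. smul (d 1 a 0) c - \<mu> a (d 2 c))" for a
      unfolding lin_def
      by (auto simp: vsp_intros lin_vsp[OF \<mu>(1)] lin_vsp[OF d2] lin_plus[OF d2] lin_smul[OF d2]
          lin_plus[OF \<mu>(1)] lin_smul[OF \<mu>(1)] smul_add smul_diff smul_smul mult.commute)
    have R: "lin (b 1) (b 2) (\<lambda>a. smul (d 1 a 0) c - \<mu> a (d 2 c))" if "c \<in> vsp (b 2)" for c
      unfolding lin_def using that
      by (auto simp: vsp_intros lin_vsp[OF \<mu>(2)] lin_plus[OF d1] lin_smul[OF d1]
          lin_plus[OF \<mu>(2)] lin_smul[OF \<mu>(2)] smul_add_left smul_diff smul_smul)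
    have "d 3 (\<nu> (ev j) c) = smul (d 1 (ev j) 0) c - \<mu> (ev j) (d 2 c)" if j: "j < b 1" for j
      using lin_compose[OF right d3] L _ c
    proof (rule lin_ext)
      fix k assume k: "k < b 2"
      show "d 3 (\<nu> (ev j) (ev k)) = smul (d 1 (ev j) 0) (ev k) - \<mu> (ev j) (d 2 (ev k))"
        unfolding \<nu>_def using Y[OF j k] by (simp add: bilin_ev[OF j k])
    qed
    then show ?thesis
      using lin_ext[OF lin_compose[OF left d3] R[OF c] _ a] by blast
  qed
  show thesis using that[OF right left leibniz] .
qed

declare One_nat_def [symmetric, simp del]

text \<open>As \<open>F_4\<close> is zero, \<open>d 3\<close> is injective and products of total
  degree at least 4 vanish. Associativity for three factors of degree 1 and the Leibniz rule in
  total degree 4 are therefore verified after applying \<open>d 3\<close>.\<close>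

lemma exists_dga_structure:
  assumes length: "\<And>i. 4 \<le> i \<Longrightarrow> b i = 0"
  shows "\<exists>mult. is_dga_structure b D mult"
proof -
  obtain \<mu> where \<mu>: "\<And>a. lin (b 1) (b 2) (\<mu> a)" "\<And>c. lin (b 1) (b 2) (\<lambda>a. \<mu> a c)"
    and \<mu>_square: "\<And>a. \<mu> a a = 0" and \<mu>_anti: "\<And>a c. \<mu> c a = - \<mu> a c"
    and leibniz_\<mu>: "\<And>a c. a \<in> vsp (b 1) \<Longrightarrow> c \<in> vsp (b 1) \<Longrightarrow>
      d 2 (\<mu> a c) = smul (d 1 a 0) c - smul (d 1 c 0) a"
    by (rule exists_degree_1_product, rule that; assumption)
  obtain \<nu> where \<nu>: "\<And>a. lin (b 2) (b 3) (\<nu> a)" "\<And>c. lin (b 1) (b 3) (\<lambda>a. \<nu> a c)"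
    and leibniz_\<nu>: "\<And>a c. a \<in> vsp (b 1) \<Longrightarrow> c \<in> vsp (b 2) \<Longrightarrow>
      d 3 (\<nu> a c) = smul (d 1 a 0) c - \<mu> a (d 2 c)"
    using exists_degree_2_product[OF \<mu> leibniz_\<mu>] by metis
  have d1: "lin (b 1) (b 0) (d 1)" and d2: "lin (b 2) (b 1) (d 2)" and d3: "lin (b 3) (b 2) (d 3)"
    using d_lin[of 1] d_lin[of 2] d_lin[of 3] by (simp_all add: One_nat_def)
  have dd1: "d 1 (d 2 a) = 0" if "a \<in> vsp (b 2)" for a using d_d[of 1 a] that by simp
  have dd2: "d 2 (d 3 a) = 0" if "a \<in> vsp (b 3)" for a using d_d[of 2 a] that by simp
  note vsp = vsp_intros lin_vsp[OF \<mu>(1)] lin_vsp[OF \<nu>(1)] lin_vsp[OF d1] lin_vsp[OF d2] lin_vsp[OF d3]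
  note lins = lin_plus[OF \<mu>(1)] lin_plus[OF \<mu>(2)] lin_plus[OF \<nu>(1)] lin_plus[OF \<nu>(2)]
    lin_minus2[OF \<mu>(1)] lin_minus2[OF \<mu>(2)] lin_minus2[OF \<nu>(1)] lin_minus2[OF \<nu>(2)]
    lin_smul[OF \<mu>(1)] lin_smul[OF \<mu>(2)] lin_smul[OF \<nu>(1)] lin_smul[OF \<nu>(2)]
    lin_zero[OF \<mu>(1)] lin_zero[OF \<mu>(2)] lin_zero[OF \<nu>(1)] lin_zero[OF \<nu>(2)]
  note dlins = d_plus d_minus d_smul lin_zero[OF d_lin]
  have d3_inj: "a = c" if "a \<in> vsp (b 3)" "c \<in> vsp (b 3)" "d 3 a = d 3 c" for a c
  proof -
    have "d 3 (a - c) = 0" using that by (simp add: d_minus)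
    moreover have "a - c \<in> vsp (b 3)" using that by (simp add: vsp_diff)
    ultimately obtain u where "u \<in> vsp (b 4)" "a - c = d 4 u"
      using boundary[of 3 "a - c"] by auto
    then have "a - c = 0" by (simp add: length vsp_0_eq lin_zero[OF d_lin])
    then show ?thesis by simp
  qed
  have big: "a = 0" if "a \<in> vsp (b i)" "4 \<le> i" for a :: "nat \<Rightarrow> ('v, 'k) mpoly" and i
    using that length vsp_0_eq by metis
  \<comment> \<open>The product of degrees 2 and 1 exchanges the factors of \<open>\<nu>\<close>,
    the sign being positive. Every case left at 0 lands in degree 4 or higher, where the module is
    zero.\<close>
  define mult where "mult = (\<lambda>(i::nat) (j::nat) (a :: nat \<Rightarrow> ('v, 'k) mpoly) (c :: nat \<Rightarrow> ('v, 'k) mpoly).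
     if i = 0 then smul (a 0) c else if j = 0 then smul (c 0) a
     else if i = 1 \<and> j = 1 then \<mu> a c
     else if i = 1 \<and> j = 2 then \<nu> a c
     else if i = 2 \<and> j = 1 then \<nu> c a else 0)"
  have closed: "mult i j a c \<in> vsp (b (i + j))" if "a \<in> vsp (b i)" "c \<in> vsp (b j)" for i j a c
    using that by (auto simp: mult_def vsp)
  have add1: "mult i j (a + a') c = mult i j a c + mult i j a' c"
    if "a \<in> vsp (b i)" "a' \<in> vsp (b i)" "c \<in> vsp (b j)" for i j a a' c
    using that by (auto simp: mult_def lins smul_add smul_add_left)
  have add2: "mult i j a (c + c') = mult i j a c + mult i j a c'"
    if "a \<in> vsp (b i)" "c \<in> vsp (b j)" "c' \<in> vsp (b j)" for i j a c c'
    using that by (auto simp: mult_def lins smul_add smul_add_left)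
  have scale1: "mult i j (smul s a) c = smul s (mult i j a c)"
    if "a \<in> vsp (b i)" "c \<in> vsp (b j)" for i j s a c
    using that by (auto simp: mult_def lins smul_smul mult.commute)
  have scale2: "mult i j a (smul s c) = smul s (mult i j a c)"
    if "a \<in> vsp (b i)" "c \<in> vsp (b j)" for i j s a c
    using that by (auto simp: mult_def lins smul_smul mult.commute)
  have mult_0: "mult 0 j a c = smul (a 0) c" for j a c by (simp add: mult_def)
  have mult_0': "mult j 0 a c = smul (c 0) a" if "a \<in> vsp (b j)" "c \<in> vsp (b 0)" for j a c
    using that smul_b_0_commute by (auto simp: mult_def)
  have unit: "mult 0 j (ev 0) a = a \<and> mult j 0 a (ev 0) = a" if "a \<in> vsp (b j)" for j a
    using that mult_0'[OF that, of "ev 0"] b_0 by (simp add: mult_0 ev_vsp) (simp add: ev_def)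
  have comm: "mult i j a c = smul ((-1) ^ (i * j)) (mult j i c a)"
    if "a \<in> vsp (b i)" "c \<in> vsp (b j)" for i j a c
  proof -
    consider "i = 0" | "j = 0" | "i = 1" "j = 1" | "i \<noteq> 0" "j \<noteq> 0" "\<not> (i = 1 \<and> j = 1)" by blast
    then show ?thesis
    proof cases
      case 1
      then show ?thesis using that(1) mult_0'[OF that(2)] by (simp add: mult_0)
    next
      case 2
      then show ?thesis using that(2) mult_0'[OF that(1)] by (simp add: mult_0)
    next
      case 3
      have "smul (- 1) (\<mu> c a) = \<mu> a c"
        unfolding smul_minus_left smul_one by (rule \<mu>_anti[symmetric])
      moreover have "mult 1 1 a c = \<mu> a c" "mult 1 1 c a = \<mu> c a" by (simp_all add: mult_def)
      ultimately show ?thesis by (simp only: 3 mult_1 power_one_right)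
    next
      case 4
      have prods: "mult 1 2 a c = \<nu> a c" "mult 2 1 a c = \<nu> c a" "mult 1 2 c a = \<nu> c a" "mult 2 1 c a = \<nu> a c"
        by (simp_all add: mult_def)
      have sign: "(- 1 :: ('v, 'k) mpoly) ^ (1 * 2) = 1" "(- 1 :: ('v, 'k) mpoly) ^ (2 * 1) = 1"
        by (rule neg_one_even_power; simp)+
      show ?thesis
      proof (cases "i = 1 \<and> j = 2 \<or> i = 2 \<and> j = 1")
        case True
        then show ?thesis
          by (elim disjE conjE) (simp_all only: prods sign smul_one)
      next
        case False
        then have "\<not> (i = 1 \<and> j = 2)" "\<not> (i = 2 \<and> j = 1)" "\<not> (j = 1 \<and> i = 2)" "\<not> (j = 2 \<and> i = 1)"
          "\<not> (j = 1 \<and> i = 1)" using 4 by blast+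
        then have "mult i j a c = 0" "mult j i c a = 0" unfolding mult_def using 4 by (simp_all only: if_False)
        then show ?thesis by (simp only: smul_zero)
      qed
    qed
  qed
  have square: "mult i i a a = 0" if "odd i" for i a
    using that by (auto simp: mult_def \<mu>_square)
  have assoc: "mult (i + j) k (mult i j a c) f = mult i (j + k) a (mult j k c f)"
    if a: "a \<in> vsp (b i)" and c: "c \<in> vsp (b j)" and f: "f \<in> vsp (b k)" for i j k a c f
  proof -
    consider "i = 0" | "j = 0" | "k = 0" | "i = 1" "j = 1" "k = 1" | "4 \<le> i + j + k"
      by linarith
    then show ?thesis
    proof cases
      case 1
      then show ?thesis using scale1[OF c f] by (simp add: mult_0)
    next
      case 2
      then show ?thesis using scale1[OF a f] scale2[OF a f] mult_0'[OF a] c by (simp add: mult_0)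
    next
      case 3
      then show ?thesis
        using mult_0'[OF closed[OF a c]] mult_0'[OF c] scale2[OF a c] f by simp
    next
      case 4
      then have acf: "a \<in> vsp (b 1)" "c \<in> vsp (b 1)" "f \<in> vsp (b 1)" using a c f by auto
      have "d 3 (\<nu> f (\<mu> a c)) = smul (d 1 f 0) (\<mu> a c)
          - (smul (d 1 a 0) (\<mu> f c) - smul (d 1 c 0) (\<mu> f a))"
        using acf by (simp add: leibniz_\<nu> leibniz_\<mu> vsp lins)
      also have "\<dots> = smul (d 1 a 0) (\<mu> c f) - (smul (d 1 c 0) (\<mu> a f) - smul (d 1 f 0) (\<mu> a c))"
        using \<mu>_anti[of f c] \<mu>_anti[of f a] by (simp add: smul_minus)
      also have "\<dots> = d 3 (\<nu> a (\<mu> c f))"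
        using acf by (simp add: leibniz_\<nu> leibniz_\<mu> vsp lins)
      finally have "\<nu> f (\<mu> a c) = \<nu> a (\<mu> c f)"
        by (rule d3_inj[rotated 2]) (use acf in \<open>simp_all add: vsp\<close>)
      then show ?thesis using 4 by (simp add: mult_def)
    next
      case 5
      then show ?thesis
        using big[OF closed[OF closed[OF a c] f]] big[OF closed[OF a closed[OF c f]]]
        by (simp add: add.assoc)
    qed
  qed
  have leibniz: "d (i + j) (mult i j a c) =
      mult (i - 1) j (d i a) c + smul ((-1) ^ i) (mult i (j - 1) a (d j c))"
    if a: "a \<in> vsp (b i)" and c: "c \<in> vsp (b j)" for i j a c
  proof -
    consider "i = 0" | "j = 0" "1 \<le> i" | "i = 1" "j = 1" | "i = 1" "j = 2" | "i = 2" "j = 1"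
      | "i = 1" "j = 3" | "i = 2" "j = 2" | "i = 3" "j = 1" | "5 \<le> i + j" "1 \<le> i" "1 \<le> j"
    proof -
      consider "i = 0" | "j = 0" "1 \<le> i" | "5 \<le> i + j" "1 \<le> i" "1 \<le> j" | "1 \<le> i" "1 \<le> j" "i + j \<le> 4"
        by linarith
      then show thesis
      proof cases
        case 4
        then have "i = 1 \<or> i = 2 \<or> i = 3" "j = 1 \<or> j = 2 \<or> j = 3"
          and "\<not> (i = 2 \<and> j = 3)" "\<not> (i = 3 \<and> j = 2)" "\<not> (i = 3 \<and> j = 3)" by linarith+
        then show thesis using that(3-8) by metis
      qed (rule that(1) that(2) that(9); assumption)+
    qed
    then show ?thesis
    proof cases
      case 1
      then show ?thesis using c by (simp add: mult_0 d_smul dmap_0)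
    next
      case 2
      have "mult (i - 1) 0 (d i a) c = smul (c 0) (d i a)"
        using 2 c by (intro mult_0') (auto simp: d_vsp)
      moreover have "mult i 0 a 0 = 0" using mult_0'[OF a] by simp
      ultimately show ?thesis using 2 a c mult_0'[OF a] by (simp add: d_smul dmap_0)
    next
      case 3
      then show ?thesis using a c leibniz_\<mu> by (simp add: mult_def smul_minus_left)
    next
      case 4
      then show ?thesis using a c leibniz_\<nu> by (simp add: mult_def smul_minus_left)
    next
      case 5
      then show ?thesis using a c leibniz_\<nu> \<mu>_anti[of "d 2 a" c] by (simp add: mult_def)
    next
      case 6
      \<comment> \<open>In total degree 4 the product itself is zero, so the rule says that the two
        terms on the right cancel.\<close>
      have "d 3 (smul (d 1 a 0) c) = d 3 (\<nu> a (d 3 c))"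
        using a c 6 dd2 by (simp add: leibniz_\<nu> vsp dlins lins)
      then have "smul (d 1 a 0) c = \<nu> a (d 3 c)"
        by (rule d3_inj[rotated 2]) (use a c 6 in \<open>simp_all add: vsp\<close>)
      then show ?thesis using 6 by (simp add: mult_def smul_minus_left dlins)
    next
      case 7
      have "d 3 (\<nu> (d 2 a) c) = d 3 (- \<nu> (d 2 c) a)"
        using a c 7 dd1 \<mu>_anti[of "d 2 a" "d 2 c"]
        by (simp add: leibniz_\<nu> vsp lin_minus[OF d3])
      then have "\<nu> (d 2 a) c = - \<nu> (d 2 c) a"
        by (rule d3_inj[rotated 2]) (use a c 7 in \<open>simp_all add: vsp\<close>)
      then show ?thesis using 7 by (simp add: mult_def dlins)
    next
      case 8
      have "d 3 (smul (d 1 c 0) a) = d 3 (\<nu> c (d 3 a))"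
        using a c 8 dd2 by (simp add: leibniz_\<nu> vsp dlins lins)
      then have "smul (d 1 c 0) a = \<nu> c (d 3 a)"
        by (rule d3_inj[rotated 2]) (use a c 8 in \<open>simp_all add: vsp\<close>)
      then show ?thesis using 8 by (simp add: mult_def smul_minus_left dlins)
    next
      case 9
      have "mult (i - 1) j (d i a) c = 0"
        using 9 closed[OF d_vsp c, of i] by (intro big[of _ "i - 1 + j"]) auto
      moreover have "mult i (j - 1) a (d j c) = 0"
        using 9 closed[OF a d_vsp, of j] by (intro big[of _ "i + (j - 1)"]) auto
      moreover have "mult i j a c = 0"
        using 9 closed[OF a c] by (intro big[of _ "i + j"]) auto
      ultimately show ?thesis by (simp add: dlins)
    qed
  qed
  have ev0: "(ev 0 :: nat \<Rightarrow> ('v, 'k) mpoly) \<in> vsp (b 0)" using b_0 by (simp add: ev_vsp)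
  have ex_unit: "\<exists>e\<in>vsp (b 0). \<forall>j a. a \<in> vsp (b j) \<longrightarrow> mult 0 j e a = a \<and> mult j 0 a e = a"
    by (rule bexI[OF _ ev0]) (intro allI impI unit)
  have "is_dga_structure b D mult"
    unfolding is_dga_structure_def fmod_eq vadd_eq zero_fun_def[symmetric]
    by (intro conjI allI impI ex_unit; (rule closed add1 add2 scale1 scale2 assoc comm square leibniz; assumption))
  then show ?thesis by (rule exI[of _ mult])
qed

end

section \<open>Cycles with at most five vertices\<close>

context minimal_resolution begin

text \<open>Comparing the resolution with a free resolution \<open>0 \<rightarrow> Q\<^sup>l \<rightarrow> Q\<^sup>m \<rightarrow> Q\<^sup>n \<rightarrow> Q\<close> of the
  same ideal by chain maps \<open>\<phi>\<close>, \<open>\<psi>\<close> and a homotopy \<open>h\<close> from \<open>\<psi>\<phi>\<close> to the identity,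
  one gets \<open>d\<^sub>4 h\<^sub>3 d\<^sub>4 = d\<^sub>4\<close>, which contradicts minimality if \<open>F\<^sub>4 \<noteq> 0\<close>.\<close>

lemma betti_4_eq_0:
  assumes \<delta>1: "lin n 1 \<delta>1" and \<delta>2: "lin m n \<delta>2" and \<delta>3: "lin l m \<delta>3"
    and image: "(\<lambda>v. \<delta>1 v 0) ` vsp n = I"
    and ker1: "{v \<in> vsp n. \<delta>1 v = 0} = \<delta>2 ` vsp m"
    and ker2: "{v \<in> vsp m. \<delta>2 v = 0} = \<delta>3 ` vsp l"
    and ker3: "\<And>v. v \<in> vsp l \<Longrightarrow> \<delta>3 v = 0 \<Longrightarrow> v = 0"
  shows "b 4 = 0"
proof (rule ccontr)
  assume "b 4 \<noteq> 0"
  then have c: "0 < b 4" by simp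
  have d1: "lin (b 1) 1 (d 1)" and d2: "lin (b 2) (b 1) (d 2)" and d3: "lin (b 3) (b 2) (d 3)"
    and d4: "lin (b 4) (b 3) (d 4)"
    using d_lin[of 1] d_lin[of 2] d_lin[of 3] d_lin[of 4] b_0 by (simp_all add: One_nat_def)
  have ex1: "v \<in> d 2 ` vsp (b 2)" if "v \<in> vsp (b 1)" "d 1 v = 0" for v
    using exact[of 1] that by auto
  have ex2: "v \<in> d 3 ` vsp (b 3)" if "v \<in> vsp (b 2)" "d 2 v = 0" for v
    using exact[of 2] that by auto
  have ex3: "v \<in> d 4 ` vsp (b 4)" if "v \<in> vsp (b 3)" "d 3 v = 0" for v
    using exact[of 3] that by auto
  have dd: "d 1 (d 2 v) = 0" if "v \<in> vsp (b 2)" for v using d_d[of 1] that by simp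
  have dd': "d 2 (d 3 v) = 0" if "v \<in> vsp (b 3)" for v using d_d[of 2] that by simp
  have dd'': "d 3 (d 4 v) = 0" if "v \<in> vsp (b 4)" for v using d_d[of 3] that by simp
  have \<delta>\<delta>: "\<delta>1 (\<delta>2 v) = 0" if "v \<in> vsp m" for v using ker1 that by blast
  have \<delta>\<delta>': "\<delta>2 (\<delta>3 v) = 0" if "v \<in> vsp l" for v using ker2 that by blast
  have "\<delta>1 v \<in> d 1 ` vsp (b 1)" if v: "v \<in> vsp n" for v
  proof -
    have "\<delta>1 v 0 \<in> I" using image v by blast
    then obtain u where "u \<in> vsp (b 1)" "d 1 u 0 = \<delta>1 v 0" by (rule d1_onto_ideal)
    then have "\<delta>1 v = d 1 u" using lin_vsp[OF \<delta>1 v] lin_vsp[OF d1] by (intro vsp_1_eqI) auto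
    then show ?thesis using \<open>u \<in> vsp (b 1)\<close> by blast
  qed
  with \<delta>1 d1 obtain \<psi>1 where \<psi>1: "lin n (b 1) \<psi>1" "\<And>v. v \<in> vsp n \<Longrightarrow> d 1 (\<psi>1 v) = \<delta>1 v"
    by (rule lin_lift; blast)
  have "d 1 v \<in> \<delta>1 ` vsp n" if v: "v \<in> vsp (b 1)" for v
  proof -
    have "d 1 v 0 \<in> I" using v by (rule d1_in_ideal)
    then obtain u where "u \<in> vsp n" "\<delta>1 u 0 = d 1 v 0" using image by (metis imageE)
    then have "d 1 v = \<delta>1 u" using lin_vsp[OF \<delta>1] lin_vsp[OF d1 v] by (intro vsp_1_eqI) auto
    then show ?thesis using \<open>u \<in> vsp n\<close> by blast
  qed
  with d1 \<delta>1 obtain \<phi>1 where \<phi>1: "lin (b 1) n \<phi>1" "\<And>v. v \<in> vsp (b 1) \<Longrightarrow> \<delta>1 (\<phi>1 v) = d 1 v"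
    by (rule lin_lift; blast)
  have "lin (b 1) (b 1) (\<lambda>v. v - \<psi>1 (\<phi>1 v))"
    by (intro lin_diff lin_id lin_compose[OF \<phi>1(1) \<psi>1(1)])
  moreover have "v - \<psi>1 (\<phi>1 v) \<in> d 2 ` vsp (b 2)" if "v \<in> vsp (b 1)" for v
    using that lin_vsp[OF \<phi>1(1)] lin_vsp[OF \<psi>1(1)] \<phi>1(2) \<psi>1(2)
    by (intro ex1) (simp_all add: vsp_diff lin_minus2[OF d1])
  ultimately obtain h1 where h1: "lin (b 1) (b 2) h1"
    "\<And>v. v \<in> vsp (b 1) \<Longrightarrow> d 2 (h1 v) = v - \<psi>1 (\<phi>1 v)"
    by (rule lin_lift[OF _ d2]; blast)
  have "\<phi>1 (d 2 v) \<in> \<delta>2 ` vsp m" if "v \<in> vsp (b 2)" for v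
    unfolding ker1[symmetric]
    using that lin_vsp[OF \<phi>1(1)] lin_vsp[OF d2] \<phi>1(2) dd by simp
  with lin_compose[OF d2 \<phi>1(1)] \<delta>2 obtain \<phi>2 where \<phi>2: "lin (b 2) m \<phi>2"
    "\<And>v. v \<in> vsp (b 2) \<Longrightarrow> \<delta>2 (\<phi>2 v) = \<phi>1 (d 2 v)"
    by (rule lin_lift; blast)
  have "\<psi>1 (\<delta>2 v) \<in> d 2 ` vsp (b 2)" if "v \<in> vsp m" for v
    using that lin_vsp[OF \<psi>1(1)] lin_vsp[OF \<delta>2] \<psi>1(2) \<delta>\<delta> by (intro ex1) simp_all
  with lin_compose[OF \<delta>2 \<psi>1(1)] d2 obtain \<psi>2 where \<psi>2: "lin m (b 2) \<psi>2"
    "\<And>v. v \<in> vsp m \<Longrightarrow> d 2 (\<psi>2 v) = \<psi>1 (\<delta>2 v)"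
    by (rule lin_lift; blast)
  \<comment> \<open>The term \<open>h1 (d 2 v)\<close> has boundary
    \<open>d 2 v - \<psi>1 (\<phi>1 (d 2 v))\<close>, which is exactly the boundary of
    \<open>v - \<psi>2 (\<phi>2 v)\<close>; the difference is thus a cycle and lifts to
    \<open>h2\<close>.\<close>
  have "lin (b 2) (b 2) (\<lambda>v. v - \<psi>2 (\<phi>2 v) - h1 (d 2 v))"
    by (intro lin_diff lin_id lin_compose[OF \<phi>2(1) \<psi>2(1)] lin_compose[OF d2 h1(1)])
  moreover have "v - \<psi>2 (\<phi>2 v) - h1 (d 2 v) \<in> d 3 ` vsp (b 3)" if "v \<in> vsp (b 2)" for v
    using that lin_vsp[OF \<phi>2(1)] lin_vsp[OF \<psi>2(1)] lin_vsp[OF h1(1)] lin_vsp[OF d2] \<phi>2(2) \<psi>2(2) h1(2)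
    by (intro ex2) (simp_all add: vsp_diff lin_minus2[OF d2])
  ultimately obtain h2 where h2: "lin (b 2) (b 3) h2"
    "\<And>v. v \<in> vsp (b 2) \<Longrightarrow> d 3 (h2 v) = v - \<psi>2 (\<phi>2 v) - h1 (d 2 v)"
    by (rule lin_lift[OF _ d3]; blast)
  have "\<phi>2 (d 3 v) \<in> \<delta>3 ` vsp l" if "v \<in> vsp (b 3)" for v
    unfolding ker2[symmetric]
    using that lin_vsp[OF \<phi>2(1)] lin_vsp[OF d3] \<phi>2(2) dd' lin_zero[OF \<phi>1(1)] by simp
  with lin_compose[OF d3 \<phi>2(1)] \<delta>3 obtain \<phi>3 where \<phi>3: "lin (b 3) l \<phi>3"
    "\<And>v. v \<in> vsp (b 3) \<Longrightarrow> \<delta>3 (\<phi>3 v) = \<phi>2 (d 3 v)"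
    by (rule lin_lift; blast)
  have "\<psi>2 (\<delta>3 v) \<in> d 3 ` vsp (b 3)" if "v \<in> vsp l" for v
    using that lin_vsp[OF \<psi>2(1)] lin_vsp[OF \<delta>3] \<psi>2(2) \<delta>\<delta>' lin_zero[OF \<psi>1(1)]
    by (intro ex2) simp_all
  with lin_compose[OF \<delta>3 \<psi>2(1)] d3 obtain \<psi>3 where \<psi>3: "lin l (b 3) \<psi>3"
    "\<And>v. v \<in> vsp l \<Longrightarrow> d 3 (\<psi>3 v) = \<psi>2 (\<delta>3 v)"
    by (rule lin_lift; blast)
  have "lin (b 3) (b 3) (\<lambda>v. v - \<psi>3 (\<phi>3 v) - h2 (d 3 v))"
    by (intro lin_diff lin_id lin_compose[OF \<phi>3(1) \<psi>3(1)] lin_compose[OF d3 h2(1)])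
  moreover have "v - \<psi>3 (\<phi>3 v) - h2 (d 3 v) \<in> d 4 ` vsp (b 4)" if "v \<in> vsp (b 3)" for v
    using that lin_vsp[OF \<phi>3(1)] lin_vsp[OF \<psi>3(1)] lin_vsp[OF h2(1)] lin_vsp[OF d3]
      \<phi>3(2) \<psi>3(2) h2(2) dd' lin_zero[OF h1(1)]
    by (intro ex3) (simp_all add: vsp_diff lin_minus2[OF d3])
  ultimately obtain h3 where h3: "lin (b 3) (b 4) h3"
    "\<And>v. v \<in> vsp (b 3) \<Longrightarrow> d 4 (h3 v) = v - \<psi>3 (\<phi>3 v) - h2 (d 3 v)"
    by (rule lin_lift[OF _ d4]; blast)
  define a where "a = d 4 (ev 0)"
  have ev0: "(ev 0 :: nat \<Rightarrow> ('v, 'k) mpoly) \<in> vsp (b 4)" using c by (rule ev_vsp)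
  have a: "a \<in> vsp (b 3)" "d 3 a = 0" unfolding a_def using lin_vsp[OF d4 ev0] dd''[OF ev0] by auto
  \<comment> \<open>\<open>\<delta>3 (\<phi>3 a) = \<phi>2 (d 3 a) = 0\<close> and
    \<open>\<delta>3\<close> is injective; the homotopy identity at \<open>a\<close> then reduces to
    \<open>d 4 (h3 a) = a\<close>.\<close>
  have "\<phi>3 a = 0"
    by (rule ker3) (simp_all add: a \<phi>3(2) lin_zero[OF \<phi>2(1)] lin_vsp[OF \<phi>3(1)])
  then have "d 4 (h3 a) = a"
    using h3(2)[OF a(1)] a(2) by (simp add: lin_zero[OF \<psi>3(1)] lin_zero[OF h2(1)])
  then have "d 4 (ev 0 - h3 a) = 0"
    using ev0 lin_vsp[OF h3(1) a(1)] by (simp add: lin_minus2[OF d4] a_def)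
  then obtain u where "ev 0 - h3 a = d (4 + 1) u"
    using boundary[of 4 "ev 0 - h3 a"] ev0 lin_vsp[OF h3(1) a(1)] by (auto simp: vsp_diff)
  \<comment> \<open>A boundary has entries without constant term, and so does \<open>h3 a\<close>,
    because \<open>a\<close> is itself a boundary; but \<open>ev 0\<close> has the entry 1.\<close>
  then have "ordge 1 ((ev 0 - h3 a) 0)" using d_ordge_1[of "4 + 1" 0 u] c by simp
  moreover have "ordge 1 (h3 a 0)"
  proof -
    have "ordge 1 (a j * h3 (ev j) 0)" if "j < b 3" for j
      using ordge_mult[OF d_ordge_1[of 4 j "ev 0"] ordge_0, of "h3 (ev j) 0"] that by (simp add: a_def)
    then have "ordge 1 (\<Sum>j<b 3. a j * h3 (ev j) 0)" by (intro ordge_sum) simp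
    then show ?thesis using lin_expand[OF h3(1) a(1)] by (simp add: sum_fun_apply)
  qed
  ultimately have "ordge 1 (ev 0 0 :: ('v, 'k) mpoly)" using ordge_add by fastforce
  then show False by (simp add: ev_def ordge_1_iff)
qed

text \<open>A generator of the next module has a nonzero column, which requires a generator one step
  below.\<close>

lemma betti_eq_0:
  assumes "b 4 = 0" "4 \<le> i" shows "b i = 0"
  using assms(2)
proof (induction i rule: dec_induct)
  case base
  then show ?case by (rule assms(1))
next
  case (step i)
  show ?case
  proof (rule ccontr)
    assume "b (Suc i) \<noteq> 0"
    then obtain r where "r < b i" using column_nonzero[of "Suc i" 0] by auto
    then show False using step by simp
  qed
qed

end

declare One_nat_def [symmetric, simp]

context cycle_graph begin

lemma X_mod: "X (i mod n) = X i" "X (i mod n + k) = X (i + k)"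
  by (simp_all add: X_def mod_add_left_eq)

lemma X_periodic: "X (i + n) = X i"
  by (simp add: X_def)

lemma f_mod_ne: "i mod n \<noteq> j mod n \<Longrightarrow> f (i mod n) \<noteq> f (j mod n)"
  using n3 by (simp add: f_eq_iff)

lemma mod_ne: "0 < k \<Longrightarrow> k < n \<Longrightarrow> (i + k) mod n \<noteq> i mod n"
  by (metis add.commute add_cancel_right_right mod_less mod_add_left_eq nat_mod_eq_iff not_less0
      add_diff_cancel_left' dvd_imp_le mod_eq_dvd_iff_nat le_add1 not_le)

section \<open>The explicit complex of a cycle with at most five vertices\<close>

definition cyc1 :: "(nat \<Rightarrow> ('v, 'k::field) mpoly) \<Rightarrow> nat \<Rightarrow> ('v, 'k) mpoly" where
  "cyc1 v = (\<lambda>j. if j = 0 then \<Sum>i<n. v i * (X i * X (i + 1)) else 0)"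

text \<open>The linear relation between consecutive edges, which share the vertex
  \<open>i + 1\<close>.\<close>

definition syz :: "nat \<Rightarrow> nat \<Rightarrow> ('v, 'k::field) mpoly" where
  "syz i = smul (X i) (ev ((i + 1) mod n)) - smul (X (i + 2)) (ev (i mod n))"

definition cyc2 :: "(nat \<Rightarrow> ('v, 'k::field) mpoly) \<Rightarrow> nat \<Rightarrow> ('v, 'k) mpoly" where
  "cyc2 v = (\<Sum>i<n. smul (v i) (syz i))"

text \<open>For \<open>n \<le> 5\<close>, the product of all variables other than the three of
  \<open>syz i\<close>. For \<open>n = 3\<close> it is the unit 1, so the explicit complex is then
  not minimal; \<open>betti_4_eq_0\<close> asks only for exactness.\<close>

definition top_syz :: "nat \<Rightarrow> ('v, 'k::field) mpoly" where
  "top_syz i = (if n = 3 then 1 else if n = 4 then X (i + 3) else X (i + 3) * X (i + 4))"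

definition cyc3 :: "(nat \<Rightarrow> ('v, 'k::field) mpoly) \<Rightarrow> nat \<Rightarrow> ('v, 'k) mpoly" where
  "cyc3 v = (\<lambda>j. if j < n then v 0 * top_syz j else 0)"

lemma n_pos: "0 < n"
  using n3 by simp

lemma cyc1_lin: "lin n 1 cyc1"
  unfolding lin_def cyc1_def
  by (auto simp: vsp_def fun_eq_iff distrib_right sum.distrib sum_distrib_left mult.assoc)

lemma syz_vsp: "syz i \<in> vsp n"
  unfolding syz_def using n_pos by (intro vsp_diff vsp_smul ev_vsp) auto

lemma cyc2_lin: "lin n n cyc2"
  unfolding cyc2_def using syz_vsp by (rule lin_combination)

lemma cyc3_lin: "lin 1 n cyc3"
  unfolding lin_def cyc3_def by (auto simp: vsp_def fun_eq_iff distrib_right mult.assoc)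

lemma cyc1_ev: "cyc1 (ev (i mod n)) 0 = (X i * X (i + 1) :: ('v, 'k::field) mpoly)"
proof -
  have "cyc1 (ev (i mod n)) 0 = (\<Sum>j<n. if i mod n = j then X j * X (j + 1) else 0 :: ('v, 'k) mpoly)"
    unfolding cyc1_def if_P[OF refl] by (intro sum.cong) (auto simp: ev_def)
  then show ?thesis using n_pos by (simp add: X_mod)
qed

lemma cyc1_syz: "cyc1 (syz i) = (0 :: nat \<Rightarrow> ('v, 'k::field) mpoly)"
proof (rule vsp_1_eqI)
  have ev: "(ev (j mod n) :: nat \<Rightarrow> ('v, 'k) mpoly) \<in> vsp n" for j using n_pos by (simp add: ev_vsp)
  have "cyc1 (syz i) 0 = X i * cyc1 (ev ((i + 1) mod n)) 0 - X (i + 2) * (cyc1 (ev (i mod n)) 0 :: ('v, 'k) mpoly)"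
    unfolding syz_def
    by (simp add: lin_minus2[OF cyc1_lin] lin_smul[OF cyc1_lin] vsp_smul ev)
  also have "\<dots> = X i * (X (i + 1) * X (i + 1 + 1)) - X (i + 2) * (X i * X (i + 1))"
    unfolding cyc1_ev ..
  also have "i + 1 + 1 = i + 2" by simp
  finally show "cyc1 (syz i) 0 = (0 :: nat \<Rightarrow> ('v, 'k) mpoly) 0" by (simp add: mult_ac)
qed (simp_all add: lin_vsp[OF cyc1_lin syz_vsp])

lemma syz_in_image: "(syz i :: nat \<Rightarrow> ('v, 'k::field) mpoly) \<in> cyc2 ` vsp n"
proof
  have "(syz (i mod n) :: nat \<Rightarrow> ('v, 'k) mpoly) = syz i"
    unfolding syz_def X_mod by (simp add: mod_add_left_eq)
  then show "(syz i :: nat \<Rightarrow> ('v, 'k) mpoly) = cyc2 (ev (i mod n))"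
    unfolding cyc2_def using n_pos by (subst combination_ev) auto
  show "(ev (i mod n) :: nat \<Rightarrow> ('v, 'k) mpoly) \<in> vsp n" using n_pos by (simp add: ev_vsp)
qed

lemma image_cyc2_add: "u \<in> cyc2 ` vsp n \<Longrightarrow> v \<in> cyc2 ` vsp n \<Longrightarrow> u + v \<in> cyc2 ` vsp n"
  by (auto simp: lin_plus[OF cyc2_lin, symmetric] intro!: imageI vsp_add)

lemma image_cyc2_smul: "u \<in> cyc2 ` vsp n \<Longrightarrow> smul s u \<in> cyc2 ` vsp n"
  by (auto simp: lin_smul[OF cyc2_lin, symmetric] intro!: imageI vsp_smul)

lemma image_cyc2_minus: "u \<in> cyc2 ` vsp n \<Longrightarrow> - u \<in> cyc2 ` vsp n"
  using image_cyc2_smul[of u "-1"] by (simp add: smul_minus_left)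

section \<open>Exactness at the edges, multidegree by multidegree\<close>

definition edge_mon :: "nat \<Rightarrow> 'v \<Rightarrow>\<^sub>0 nat" where
  "edge_mon i = xm (f (i mod n)) + xm (f ((i + 1) mod n))"

text \<open>A single term times a basis vector; under \<open>cyc1\<close> it becomes a term with
  exponent \<open>\<nu> + edge_mon i\<close>, its multidegree.\<close>

definition term_vec :: "('v \<Rightarrow>\<^sub>0 nat) \<Rightarrow> 'k::field \<Rightarrow> nat \<Rightarrow> nat \<Rightarrow> ('v, 'k) mpoly" where
  "term_vec \<nu> c i = smul (Poly_Mapping.single \<nu> c) (ev (i mod n))"

lemma consecutive_distinct:
  "f (i mod n) \<noteq> f ((i + 1) mod n)" "f (i mod n) \<noteq> f ((i + 2) mod n)" "f ((i + 1) mod n) \<noteq> f ((i + 2) mod n)"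
proof -
  show "f (i mod n) \<noteq> f ((i + 1) mod n)" using mod_ne[of 1 i] n3 by (intro f_mod_ne) auto
  show "f (i mod n) \<noteq> f ((i + 2) mod n)" using mod_ne[of 2 i] n3 by (intro f_mod_ne) auto
  show "f ((i + 1) mod n) \<noteq> f ((i + 2) mod n)"
  proof (rule f_mod_ne)
    have shift: "i + 2 = i + 1 + 1" by simp
    have "(i + 1 + 1) mod n \<noteq> (i + 1) mod n" by (rule mod_ne) (use n3 in simp_all)
    then show "(i + 1) mod n \<noteq> (i + 2) mod n" unfolding shift by (rule not_sym)
  qed
qed

text \<open>Equal multidegrees force \<open>X (i + 2)\<close> to divide the first coefficient and
  \<open>X i\<close> the second, with a common cofactor \<open>\<rho>\<close>; the difference is
  that cofactor times \<open>syz i\<close>.\<close>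

lemma adjacent_terms:
  fixes c :: "'k::field"
  assumes eq: "\<nu> + edge_mon i = \<nu>' + edge_mon (i + 1)"
  shows "term_vec \<nu>' c (i + 1) - term_vec \<nu> c i \<in> cyc2 ` vsp n"
proof -
  let ?a = "f (i mod n)" and ?b = "f ((i + 1) mod n)" and ?c = "f ((i + 2) mod n)"
  have shift: "i + 1 + 1 = i + 2" by simp
  have eq': "lookup \<nu> v + (lookup (xm ?a) v + lookup (xm ?b) v) = lookup \<nu>' v + (lookup (xm ?b) v + lookup (xm ?c) v)" for v
    using arg_cong[OF eq, of "\<lambda>m. lookup m v"] unfolding edge_mon_def shift by (simp add: lookup_add)
  define \<rho> where "\<rho> = \<nu> - xm ?c"
  have "1 \<le> lookup \<nu> ?c"
    using eq'[of ?c] consecutive_distinct[of i] by (simp add: lookup_xm)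
  then have \<nu>: "\<nu> = \<rho> + xm ?c"
    by (intro poly_mapping_eqI) (auto simp: \<rho>_def lookup_add lookup_minus lookup_xm)
  have \<nu>': "\<nu>' = \<rho> + xm ?a"
  proof (rule poly_mapping_eqI)
    fix v
    show "lookup \<nu>' v = lookup (\<rho> + xm ?a) v"
      using eq'[of v] unfolding \<nu> by (simp add: lookup_add)
  qed
  have "(Poly_Mapping.single \<nu>' c) = Poly_Mapping.single \<rho> c * X i"
    and "Poly_Mapping.single \<nu> c = Poly_Mapping.single \<rho> c * X (i + 2)"
    unfolding \<nu> \<nu>' X_def Var_def by (simp_all add: mult_single)
  then have "term_vec \<nu>' c (i + 1) - term_vec \<nu> c i = smul (Poly_Mapping.single \<rho> c) (syz i)"
    unfolding term_vec_def syz_def by (simp add: smul_diff smul_smul)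
  then show ?thesis using image_cyc2_smul[OF syz_in_image] by simp
qed

text \<open>The edge in between takes one vertex from each outer edge, so it divides the common
  monomial, and the passage splits into two adjacent ones.\<close>

lemma terms_at_distance_2:
  fixes c :: "'k::field"
  assumes eq: "\<nu> + edge_mon i = \<nu>' + edge_mon (i + 2)"
  shows "term_vec \<nu>' c (i + 2) - term_vec \<nu> c i \<in> cyc2 ` vsp n"
proof -
  let ?b = "f ((i + 1) mod n)" and ?c = "f ((i + 2) mod n)"
  define \<nu>'' where "\<nu>'' = \<nu> + edge_mon i - edge_mon (i + 1)"
  have shift: "i + 1 + 1 = i + 2" by simp
  have "lookup (edge_mon (i + 1)) v \<le> lookup (\<nu> + edge_mon i) v" for v
  proof -
    have "1 \<le> lookup (\<nu> + edge_mon i) ?b"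
      unfolding edge_mon_def by (simp add: lookup_add lookup_xm)
    moreover have "1 \<le> lookup (\<nu> + edge_mon i) ?c"
      unfolding eq by (simp add: edge_mon_def lookup_add lookup_xm)
    ultimately show ?thesis
      using consecutive_distinct[of i] unfolding edge_mon_def[of "i + 1"] shift
      by (auto simp: lookup_add[of "xm _" "xm _"] lookup_xm)
  qed
  then have mid: "\<nu> + edge_mon i = \<nu>'' + edge_mon (i + 1)"
    by (intro poly_mapping_eqI) (simp add: \<nu>''_def lookup_add[of _ "edge_mon (i + 1)"] lookup_minus)
  have "term_vec \<nu>'' c (i + 1) - term_vec \<nu> c i \<in> cyc2 ` vsp n"
    using mid by (rule adjacent_terms)
  moreover have "term_vec \<nu>' c (i + 1 + 1) - term_vec \<nu>'' c (i + 1) \<in> cyc2 ` vsp n"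
    using mid eq unfolding shift[symmetric] by (intro adjacent_terms) simp
  ultimately have "(term_vec \<nu>'' c (i + 1) - term_vec \<nu> c i)
      + (term_vec \<nu>' c (i + 1 + 1) - term_vec \<nu>'' c (i + 1)) \<in> cyc2 ` vsp n"
    by (rule image_cyc2_add)
  moreover have "(x - y) + (z - x) = z - y" for x y z :: "nat \<Rightarrow> ('v, 'k) mpoly"
    by (simp add: algebra_simps)
  ultimately show ?thesis unfolding shift by (simp only:)
qed

text \<open>With at most five vertices any two edges have cyclic distance at most two; distance
  three first occurs for \<open>n = 6\<close>.\<close>

lemma equal_multidegree_terms:
  fixes c :: "'k::field"
  assumes n5: "n \<le> 5" and i: "i < n" and j: "j < n" and eq: "\<nu> + edge_mon i = \<nu>' + edge_mon j"
  shows "term_vec \<nu>' c j - term_vec \<nu> c i \<in> cyc2 ` vsp n"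
proof -
  have periodic: "edge_mon (k mod n) = edge_mon k" "term_vec \<kappa> c (k mod n) = term_vec \<kappa> c k" for k \<kappa>
    unfolding edge_mon_def term_vec_def by (simp_all add: mod_add_left_eq)
  have up: "term_vec \<nu>' c j - term_vec \<nu> c i \<in> cyc2 ` vsp n"
    if "j = (i + 1) mod n \<or> j = (i + 2) mod n" "\<nu> + edge_mon i = \<nu>' + edge_mon j" for i j \<nu> \<nu>'
    using that adjacent_terms[of \<nu> i \<nu>' c] terms_at_distance_2[of \<nu> i \<nu>' c] by (auto simp: periodic)
  consider "i = j" | "j = (i + 1) mod n \<or> j = (i + 2) mod n" | "i = (j + 1) mod n \<or> i = (j + 2) mod n"
  proof -
    have "n = 3 \<or> n = 4 \<or> n = 5" using n3 n5 by linarith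
    then have "i = j \<or> (j = (i + 1) mod n \<or> j = (i + 2) mod n) \<or> (i = (j + 1) mod n \<or> i = (j + 2) mod n)"
    proof (elim disjE)
      assume n: "n = 3"
      then have "i = 0 \<or> i = 1 \<or> i = 2" "j = 0 \<or> j = 1 \<or> j = 2" using i j by linarith+
      then show ?thesis unfolding n by (elim disjE) simp_all
    next
      assume n: "n = 4"
      then have "i = 0 \<or> i = 1 \<or> i = 2 \<or> i = 3" "j = 0 \<or> j = 1 \<or> j = 2 \<or> j = 3" using i j by linarith+
      then show ?thesis unfolding n by (elim disjE) simp_all
    next
      assume n: "n = 5"
      then have "i = 0 \<or> i = 1 \<or> i = 2 \<or> i = 3 \<or> i = 4" "j = 0 \<or> j = 1 \<or> j = 2 \<or> j = 3 \<or> j = 4"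
        using i j by linarith+
      then show ?thesis unfolding n by (elim disjE) simp_all
    qed
    then show thesis using that by blast
  qed
  then show ?thesis
  proof cases
    case 1
    then have "\<nu> = \<nu>'" using eq by simp
    then show ?thesis using 1 vsp_zero lin_zero[OF cyc2_lin] by (metis diff_self imageI)
  next
    case 2
    then show ?thesis using eq by (rule up)
  next
    case 3
    then have "term_vec \<nu> c i - term_vec \<nu>' c j \<in> cyc2 ` vsp n" using eq[symmetric] by (rule up)
    then have "- (term_vec \<nu> c i - term_vec \<nu>' c j) \<in> cyc2 ` vsp n" by (rule image_cyc2_minus)
    then show ?thesis by simp
  qed
qed

lemma cyc1_term:
  "cyc1 (term_vec \<nu> c i) 0 = Poly_Mapping.single (\<nu> + edge_mon i) (c :: 'k::field)"
proof -
  have ev: "(ev (i mod n) :: nat \<Rightarrow> ('v, 'k) mpoly) \<in> vsp n" using n_pos by (simp add: ev_vsp)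
  have "cyc1 (term_vec \<nu> c i) 0 = Poly_Mapping.single \<nu> c * (X i * X (i + 1))"
    unfolding term_vec_def by (simp add: lin_smul[OF cyc1_lin ev] cyc1_ev)
  then show ?thesis unfolding X_def Var_def edge_mon_def by (simp add: mult_single)
qed

lemma mpoly_induct:
  fixes p :: "('a \<Rightarrow>\<^sub>0 nat) \<Rightarrow>\<^sub>0 'b::comm_monoid_add"
  assumes "P 0" "\<And>m c. P (Poly_Mapping.single m c)" "\<And>p q. P p \<Longrightarrow> P q \<Longrightarrow> P (p + q)"
  shows "P p"
proof (induction p rule: update_induct)
  case const
  show ?case by (rule assms(1))
next
  case (update p m c)
  have "Poly_Mapping.update m c p = Poly_Mapping.single m c + p"
    using update(1) by (intro poly_mapping_eqI)
      (auto simp: lookup_update lookup_add lookup_single when_def in_keys_iff)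
  then show ?case using assms(2,3) update by simp
qed

text \<open>For each monomial of the edge ideal choose an edge dividing it. Replacing each term of a
  vector by the chosen one of the same multidegree changes it by a combination of the \<open>syz i\<close>,
  and sends the kernel of \<open>cyc1\<close> to \<open>0\<close>.\<close>

lemma kernel_cyc1:
  fixes v :: "nat \<Rightarrow> ('v, 'k::field) mpoly"
  assumes n5: "n \<le> 5" and v: "v \<in> vsp n" "cyc1 v = 0"
  shows "v \<in> cyc2 ` vsp n"
proof -
  have "\<forall>\<mu>. \<exists>x. (\<exists>i \<nu>. i < n \<and> \<mu> = \<nu> + edge_mon i) \<longrightarrow> fst x < n \<and> \<mu> = snd x + edge_mon (fst x)"
    by fastforce
  from choice[OF this] obtain g where g: "\<forall>\<mu>. (\<exists>i \<nu>. i < n \<and> \<mu> = \<nu> + edge_mon i) \<longrightarrow>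
      fst (g \<mu>) < n \<and> \<mu> = snd (g \<mu>) + edge_mon (fst (g \<mu>))"
    by (elim exE)
  define \<iota> where "\<iota> = (\<lambda>\<mu>. fst (g \<mu>))"
  define \<kappa> where "\<kappa> = (\<lambda>\<mu>. snd (g \<mu>))"
  have chosen: "\<iota> \<mu> < n \<and> \<mu> = \<kappa> \<mu> + edge_mon (\<iota> \<mu>)" if "i < n" "\<mu> = \<nu> + edge_mon i" for \<mu> i \<nu>
    unfolding \<iota>_def \<kappa>_def using g that by blast
  define \<Phi> where "\<Phi> = (\<lambda>p :: ('v, 'k) mpoly. \<Sum>\<mu>\<in>keys p. term_vec (\<kappa> \<mu>) (lookup p \<mu>) (\<iota> \<mu>))"
  have \<Phi>_add: "\<Phi> (p + q) = \<Phi> p + \<Phi> q" for p q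
    unfolding \<Phi>_def
    by (rule setsum_keys_plus_distrib) (simp_all add: term_vec_def single_add fun_eq_iff distrib_right)
  have \<Phi>_single: "\<Phi> (Poly_Mapping.single \<mu> c) = term_vec (\<kappa> \<mu>) c (\<iota> \<mu>)" for \<mu> c
    by (simp add: \<Phi>_def term_vec_def)
  have \<Phi>_zero: "\<Phi> 0 = 0" by (simp add: \<Phi>_def)
  \<comment> \<open>Vectors congruent to their normal form, which depends only on
    \<open>cyc1 v 0\<close>. The set is closed under addition and contains all single-term vectors,
    hence every vector.\<close>
  define A where "A = {v \<in> vsp n. v - \<Phi> (cyc1 v 0) \<in> cyc2 ` vsp n}"
  have A_add: "u + v \<in> A" if "u \<in> A" "v \<in> A" for u v
  proof -
    have "cyc1 (u + v) 0 = cyc1 u 0 + cyc1 v 0"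
      using that by (simp add: A_def lin_plus[OF cyc1_lin])
    then have "u + v - \<Phi> (cyc1 (u + v) 0) = (u - \<Phi> (cyc1 u 0)) + (v - \<Phi> (cyc1 v 0))"
      by (simp add: \<Phi>_add)
    moreover have "(u - \<Phi> (cyc1 u 0)) + (v - \<Phi> (cyc1 v 0)) \<in> cyc2 ` vsp n"
      by (rule image_cyc2_add) (use that in \<open>simp_all add: A_def\<close>)
    ultimately have "u + v - \<Phi> (cyc1 (u + v) 0) \<in> cyc2 ` vsp n" by (simp only:)
    then show ?thesis using that by (simp add: A_def vsp_add)
  qed
  have A_zero: "0 \<in> A"
  proof -
    have "(0 :: nat \<Rightarrow> ('v, 'k) mpoly) \<in> cyc2 ` vsp n"
      using lin_zero[OF cyc2_lin] vsp_zero by (metis imageI)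
    then show ?thesis by (simp add: A_def lin_zero[OF cyc1_lin] \<Phi>_zero)
  qed
  have A_term: "term_vec \<nu> c i \<in> A" if i: "i < n" for \<nu> c i
  proof -
    let ?\<mu> = "\<nu> + edge_mon i"
    have ch: "\<iota> ?\<mu> < n" "\<kappa> ?\<mu> + edge_mon (\<iota> ?\<mu>) = ?\<mu>" using chosen[OF i, of ?\<mu> \<nu>] by auto
    have "term_vec \<nu> c i - term_vec (\<kappa> ?\<mu>) c (\<iota> ?\<mu>) \<in> cyc2 ` vsp n"
      using n5 ch(1) i ch(2) by (rule equal_multidegree_terms)
    moreover have "term_vec \<nu> c i \<in> vsp n"
      unfolding term_vec_def using n_pos by (intro vsp_smul ev_vsp) simp
    ultimately show ?thesis by (simp add: A_def cyc1_term \<Phi>_single)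
  qed
  have A_smul: "smul p (ev i) \<in> A" if i: "i < n" for p i
  proof (induction p rule: mpoly_induct)
    case 1
    show ?case unfolding smul_zero_left by (rule A_zero)
  next
    case (2 m c)
    show ?case using A_term[OF i, of m c] unfolding term_vec_def mod_less[OF i] .
  next
    case (3 p q)
    then show ?case unfolding smul_add_left by (rule A_add)
  qed
  have "(\<Sum>i\<in>B. smul (v i) (ev i)) \<in> A" if "B \<subseteq> {..<n}" for B
    using finite_subset[OF that] that
    by (induction B rule: finite_induct) (auto simp: A_zero A_add A_smul)
  then have "v \<in> A" using vsp_expand[OF v(1)] by (metis order_refl)
  then show ?thesis using v(2) \<Phi>_zero by (simp add: A_def)
qed

section \<open>Exactness at the linear syzygies and injectivity of the last map\<close>

text \<open>Coordinate \<open>i + 1\<close> receives only \<open>syz i\<close>, with coefficient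
  \<open>X i\<close>, and \<open>syz (i + 1)\<close>, with coefficient \<open>- X (i + 3)\<close>.
  The kernel is thus described by a cyclic recursion.\<close>

lemma cyc2_eq_0_iff:
  fixes v :: "nat \<Rightarrow> ('v, 'k::field) mpoly"
  assumes "v \<in> vsp n"
  shows "cyc2 v = 0 \<longleftrightarrow> (\<forall>i. X i * v (i mod n) = X (i + 3) * v ((i + 1) mod n))"
proof -
  have coeff: "cyc2 v ((i + 1) mod n) = X i * v (i mod n) - X (i + 3) * v ((i + 1) mod n)" for i
  proof -
    let ?r = "(i + 1) mod n"
    have inj: "?r = (k + 1) mod n \<longleftrightarrow> i mod n = k" if "k < n" for k
    proof
      assume "?r = (k + 1) mod n"
      \<comment> \<open>Adding \<open>n - 1\<close> undoes the shift by one modulo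
        \<open>n\<close>.\<close>
      then have "(i + 1 + (n - 1)) mod n = (k + 1 + (n - 1)) mod n" by (metis mod_add_left_eq)
      then show "i mod n = k" using that by simp
    qed (auto simp: mod_add_left_eq)
    have "cyc2 v ?r = (\<Sum>k<n. v k * syz k ?r)" by (simp add: cyc2_def sum_fun_apply)
    also have "\<dots> = (\<Sum>k<n. (if i mod n = k then v k * X k else 0) - (if ?r = k then v k * X (k + 2) else 0))"
    proof (intro sum.cong refl)
      fix k assume "k \<in> {..<n}"
      then have k: "k < n" by simp
      have "syz k ?r = (if i mod n = k then X k else 0) - (if ?r = k then X (k + 2) else 0 :: ('v, 'k) mpoly)"
        unfolding syz_def ev_def minus_apply smul_apply inj[OF k] mod_less[OF k] by simp
      then show "v k * syz k ?r = (if i mod n = k then v k * X k else 0) - (if ?r = k then v k * X (k + 2) else 0)"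
        by (simp add: right_diff_distrib)
    qed
    also have "\<dots> = v (i mod n) * X (i mod n) - v ?r * X (?r + 2)"
      using n_pos by (simp add: sum_subtractf)
    also have "X (?r + 2) = X (i + 3)" unfolding X_mod by (rule arg_cong[of _ _ X]) simp
    finally show ?thesis unfolding X_mod by (simp only: mult.commute)
  qed
  show ?thesis
  proof
    assume "cyc2 v = 0"
    then show "\<forall>i. X i * v (i mod n) = X (i + 3) * v ((i + 1) mod n)"
      using coeff by (metis eq_iff_diff_eq_0 zero_fun_apply)
  next
    assume rel: "\<forall>i. X i * v (i mod n) = X (i + 3) * v ((i + 1) mod n)"
    show "cyc2 v = 0"
    proof
      fix j
      show "cyc2 v j = 0 j"
      proof (cases "j < n")
        case True
        then have "(j + n - 1 + 1) mod n = j" by simp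
        then show ?thesis using coeff[of "j + n - 1"] rel by simp
      next
        case False
        then show ?thesis using lin_vsp[OF cyc2_lin assms] by (simp add: vsp_def)
      qed
    qed
  qed
qed

lemma n_cases: "n \<le> 5 \<Longrightarrow> n = 3 \<or> n = 4 \<or> n = 5"
  using n3 by linarith

lemma top_syz_3: "n = 3 \<Longrightarrow> top_syz i = 1"
  and top_syz_4: "n = 4 \<Longrightarrow> top_syz i = X (i + 3)"
  and top_syz_5: "n = 5 \<Longrightarrow> top_syz i = X (i + 3) * X (i + 4)"
  unfolding top_syz_def by auto

lemma X_shift: "j = i + n \<Longrightarrow> X j = X i"
  using X_periodic by simp

lemma top_syz_mod: "top_syz (i mod n) = top_syz i"
  by (simp only: top_syz_def X_mod)

text \<open>Both sides of the recursion for \<open>top_syz\<close> are the product of all variables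
  except \<open>X (i + 1)\<close> and \<open>X (i + 2)\<close>.\<close>

lemma cyc2_cyc3:
  fixes v :: "nat \<Rightarrow> ('v, 'k::field) mpoly"
  assumes n5: "n \<le> 5" and v: "v \<in> vsp 1"
  shows "cyc2 (cyc3 v) = 0"
proof -
  have "X i * top_syz i = X (i + 3) * (top_syz (i + 1) :: ('v, 'k) mpoly)" for i
    using n_cases[OF n5]
  proof (elim disjE)
    assume n: "n = 3"
    have "X (i + 3) = (X i :: ('v, 'k) mpoly)" using n by (intro X_shift) simp
    then show ?thesis unfolding top_syz_3[OF n] by (simp only:)
  next
    assume n: "n = 4"
    have "X (i + 1 + 3) = (X i :: ('v, 'k) mpoly)" using n by (intro X_shift) simp
    then show ?thesis unfolding top_syz_4[OF n] by (simp only: mult.commute)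
  next
    assume n: "n = 5"
    have "X (i + 1 + 4) = (X i :: ('v, 'k) mpoly)" using n by (intro X_shift) simp
    moreover have "i + 1 + 3 = i + 4" by simp
    ultimately show ?thesis unfolding top_syz_5[OF n] by (simp only: mult_ac)
  qed
  then have "X i * cyc3 v (i mod n) = X (i + 3) * cyc3 v ((i + 1) mod n)" for i
    using n_pos by (simp add: cyc3_def top_syz_mod mult.left_commute)
  then show ?thesis using cyc2_eq_0_iff[OF lin_vsp[OF cyc3_lin v]] by blast
qed

lemma X_coprime:
  fixes p q :: "('v, 'k::field) mpoly"
  assumes "X i * p = X j * q" "i mod n \<noteq> j mod n"
  obtains s where "p = X j * s" "q = X i * s"
  using Var_coprime[OF assms(1)[unfolded X_def] f_mod_ne[OF assms(2)]] that unfolding X_def by metis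

lemma X_cancel: "X i * p = X i * q \<Longrightarrow> p = q"
  unfolding X_def by (rule Var_mult_cancel)

lemma constant_seq:
  assumes "\<And>i. r i = r (i + 1)" shows "r i = r (0 :: nat)"
  using assms by (induction i) (auto simp: Suc_eq_plus1)

text \<open>For \<open>n = 3\<close> the factors \<open>X i\<close> and \<open>X (i + 3)\<close>
  agree and cancel. For \<open>n = 4\<close> and \<open>n = 5\<close> they are coprime, and dividing
  by variables once or twice leaves a sequence that no longer depends on \<open>i\<close>.\<close>

lemma kernel_cyc2:
  fixes v :: "nat \<Rightarrow> ('v, 'k::field) mpoly"
  assumes n5: "n \<le> 5" and v: "v \<in> vsp n" "cyc2 v = 0"
  shows "v \<in> cyc3 ` vsp 1"
proof -
  \<comment> \<open>The periodic extension of \<open>v\<close> to all indices, so that the cyclic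
    relations can be followed by plain induction.\<close>
  define q where "q = (\<lambda>i. v (i mod n))"
  have rel: "X i * q i = X (i + 3) * q (i + 1)" for i
    using cyc2_eq_0_iff[OF v(1)] v(2) by (simp add: q_def)
  have "\<exists>s. \<forall>i. q i = s * top_syz i"
    using n_cases[OF n5]
  proof (elim disjE)
    assume n: "n = 3"
    have "q i = q (i + 1)" for i
    proof (rule X_cancel)
      have "X (i + 3) = (X i :: ('v, 'k) mpoly)" using n by (intro X_shift) simp
      then show "X i * q i = X i * q (i + 1)" using rel[of i] by (simp only:)
    qed
    then have "q i = q 0" for i by (rule constant_seq)
    then have "q i = q 0 * top_syz i" for i unfolding top_syz_3[OF n] mult_1_right .
    then show ?thesis by blast
  next
    assume n: "n = 4"
    have "\<exists>s. q i = X (i + 3) * s \<and> q (i + 1) = X i * s" for i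
    proof (rule X_coprime[OF rel[of i]])
      show "i mod n \<noteq> (i + 3) mod n" by (rule not_sym, rule mod_ne) (use n in simp_all)
    qed blast
    then obtain s where s: "\<And>i. q i = X (i + 3) * s i" "\<And>i. q (i + 1) = X i * s i" by metis
    have "s i = s (i + 1)" for i
    proof (rule X_cancel)
      have "X (i + 1 + 3) = (X i :: ('v, 'k) mpoly)" using n by (intro X_shift) simp
      then show "X i * s i = X i * s (i + 1)" using s(1)[of "i + 1"] s(2)[of i] by (simp only:)
    qed
    then have const: "s i = s 0" for i by (rule constant_seq)
    have "q i = s 0 * top_syz i" for i
      using s(1)[of i] unfolding top_syz_4[OF n] const[of i] by (simp only: mult.commute)
    then show ?thesis by blast
  next
    assume n: "n = 5"
    have "\<exists>s. q i = X (i + 3) * s \<and> q (i + 1) = X i * s" for i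
    proof (rule X_coprime[OF rel[of i]])
      show "i mod n \<noteq> (i + 3) mod n" by (rule not_sym, rule mod_ne) (use n in simp_all)
    qed blast
    then obtain s where s: "\<And>i. q i = X (i + 3) * s i" "\<And>i. q (i + 1) = X i * s i" by metis
    \<comment> \<open>The entry \<open>q (i + 1)\<close> has two factorisations, from the relations
      at \<open>i\<close> and at \<open>i + 1\<close>.\<close>
    have rel': "X i * s i = X (i + 4) * s (i + 1)" for i
    proof -
      have "i + 1 + 3 = i + 4" by simp
      then show ?thesis using s(1)[of "i + 1"] s(2)[of i] by (simp only:)
    qed
    have "\<exists>r. s i = X (i + 4) * r \<and> s (i + 1) = X i * r" for i
    proof (rule X_coprime[OF rel'[of i]])
      show "i mod n \<noteq> (i + 4) mod n" by (rule not_sym, rule mod_ne) (use n in simp_all)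
    qed blast
    then obtain r where r: "\<And>i. s i = X (i + 4) * r i" "\<And>i. s (i + 1) = X i * r i" by metis
    have "r i = r (i + 1)" for i
    proof (rule X_cancel)
      have "X (i + 1 + 4) = (X i :: ('v, 'k) mpoly)" using n by (intro X_shift) simp
      then show "X i * r i = X i * r (i + 1)" using r(1)[of "i + 1"] r(2)[of i] by (simp only:)
    qed
    then have const: "r i = r 0" for i by (rule constant_seq)
    have "q i = r 0 * top_syz i" for i
      using s(1)[of i] unfolding r(1)[of i] top_syz_5[OF n] const[of i] by (simp only: mult_ac)
    then show ?thesis by blast
  qed
  then obtain s where s: "\<And>i. q i = s * top_syz i" by blast
  have "v = cyc3 (smul s (ev 0))"
  proof
    fix j
    show "v j = cyc3 (smul s (ev 0)) j"
      using s[of j] v(1) by (auto simp: cyc3_def ev_def q_def vsp_def)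
  qed
  then show ?thesis by (auto intro: imageI vsp_smul ev_vsp)
qed

lemma kernel_cyc3:
  fixes v :: "nat \<Rightarrow> ('v, 'k::field) mpoly"
  assumes n5: "n \<le> 5" and v: "v \<in> vsp 1" "cyc3 v = 0"
  shows "v = 0"
proof -
  have "v 0 * top_syz 0 = 0" using fun_cong[OF v(2), of 0] n_pos by (simp add: cyc3_def)
  then have 0: "top_syz 0 * v 0 = 0" by (simp only: mult.commute)
  have "v 0 = 0"
    using n_cases[OF n5]
  proof (elim disjE)
    assume n: "n = 3"
    show ?thesis using 0 unfolding top_syz_3[OF n] by simp
  next
    assume n: "n = 4"
    show ?thesis using 0 unfolding top_syz_4[OF n] X_def by (rule Var_mult_eq_0)
  next
    assume n: "n = 5"
    show ?thesis using 0 unfolding top_syz_5[OF n] X_def mult.assoc by (rule Var_mult_eq_0[OF Var_mult_eq_0])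
  qed
  then show ?thesis using v(1) by (intro vsp_1_eqI) auto
qed

end

context cycle_resolution begin

lemma betti_4:
  assumes n5: "n \<le> 5" shows "b 4 = 0"
proof (rule betti_4_eq_0[OF cyc1_lin cyc2_lin cyc3_lin])
  show "(\<lambda>v. cyc1 v 0 :: ('v, 'k) mpoly) ` vsp n = edge_ideal E"
  proof (intro equalityI subsetI)
    fix p :: "('v, 'k) mpoly"
    assume "p \<in> edge_ideal E"
    then obtain a where a: "p = (\<Sum>i<n. a i * (X i * X (i + 1)))" by (auto simp: edge_ideal_eq)
    have "p = cyc1 (\<lambda>i. if i < n then a i else 0) 0" unfolding a cyc1_def by simp
    moreover have "(\<lambda>i. if i < n then a i else 0) \<in> vsp n" by (simp add: vsp_def)
    ultimately show "p \<in> (\<lambda>v. cyc1 v 0) ` vsp n" by (rule image_eqI)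
  qed (auto simp: edge_ideal_eq cyc1_def)
  show "{v \<in> vsp n. (cyc1 v :: nat \<Rightarrow> ('v, 'k) mpoly) = 0} = cyc2 ` vsp n"
  proof (intro equalityI subsetI)
    fix v :: "nat \<Rightarrow> ('v, 'k) mpoly"
    assume "v \<in> {v \<in> vsp n. cyc1 v = 0}"
    then show "v \<in> cyc2 ` vsp n" using kernel_cyc1[OF n5] by blast
  next
    fix v :: "nat \<Rightarrow> ('v, 'k) mpoly"
    assume "v \<in> cyc2 ` vsp n"
    then obtain u where u: "u \<in> vsp n" "v = cyc2 u" by blast
    have "cyc1 v = (\<Sum>i<n. smul (u i) (cyc1 (syz i)))"
      unfolding u(2) cyc2_def
      by (subst lin_sum[OF cyc1_lin]) (simp_all add: vsp_smul syz_vsp lin_smul[OF cyc1_lin])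
    then show "v \<in> {v \<in> vsp n. cyc1 v = 0}"
      using u lin_vsp[OF cyc2_lin] by (simp add: cyc1_syz)
  qed
  show "{v \<in> vsp n. (cyc2 v :: nat \<Rightarrow> ('v, 'k) mpoly) = 0} = cyc3 ` vsp 1"
    using kernel_cyc2[OF n5] cyc2_cyc3[OF n5] lin_vsp[OF cyc3_lin] by blast
  show "v = 0" if "v \<in> vsp 1" "cyc3 v = 0" for v :: "nat \<Rightarrow> ('v, 'k) mpoly"
    using n5 that by (rule kernel_cyc3)
qed

end

theorem mainTheorem20:
  fixes E :: "'v::finite \<Rightarrow> 'v \<Rightarrow> bool"
    and b :: "nat \<Rightarrow> nat" and deg :: "nat \<Rightarrow> nat \<Rightarrow> nat"
    and D :: "nat \<Rightarrow> nat \<Rightarrow> nat \<Rightarrow> ('v, 'k::field) mpoly"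
  assumes "card (UNIV::'v set) \<ge> 3"
    and "is_cycle_graph E"
    and "minimal_graded_free_resolution (edge_ideal E) b deg D"
  shows "(\<exists>mult. is_dga_structure b D mult) \<longleftrightarrow> card (UNIV::'v set) \<le> 5"
proof -
  let ?n = "card (UNIV :: 'v set)"
  obtain f where "bij_betw f {..<?n} (UNIV :: 'v set)"
    and "\<forall>u w. E u w \<longleftrightarrow> (\<exists>i<?n. {u, w} = {f i, f ((i + 1) mod ?n)})"
    using assms(2) unfolding is_cycle_graph_def by blast
  then interpret cycle_resolution E f ?n b deg D
    using assms by unfold_locales auto
  show ?thesis
  proof
    assume "\<exists>mult. is_dga_structure b D mult"
    then have "\<not> 6 \<le> ?n" using no_dga_structure by blast
    then show "?n \<le> 5" by simp
  next
    assume "?n \<le> 5"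
    then show "\<exists>mult. is_dga_structure b D mult"
      using exists_dga_structure betti_eq_0[OF betti_4] by blast
  qed
qed

end
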